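(* Let $n=4k+2$ with $k\ge 0$. The maximum number of nonzero entries in an $n\times n$ symmetric alternating sign matrix all of whose main diagonal entries are $0$ equals $\frac{n^2-2n+4}{2}$ (equivalently, the maximum number of edges of an alternating signed graph of order $n$ without loops is $\frac{n^2-2n+4}{4}$). Moreover, an $n\times n$ symmetric ASM with zero main diagonal has exactly $\frac{n^2-2n+4}{2}$ nonzero entries if and only if it equals the hollowed-diamond ASM $D^*_{4k+2}$.
   Context: An alternating sign matrix (ASM) is an $n\times n$ matrix with entries in $\{0,+1,-1\}$ such that in each row and each column the nonzero entries alternate in sign, beginning and ending with $+1$. An alternating signed graph of order $n$ without loops is a graph on vertices $1,\dots,n$ with edges signed $\pm1$ whose signed adjacency matrix is a symmetric ASM with zero main diagonal; its number of edges is half the number of nonzero entries. Let $n=4k+2$, $m=2k+1$, and let $D=[d_{ij}]$ be the $n\times n$ matrix with $d_{ij}=(-1)^{i+j-m-2}$ if $m+2\le i+j\le 3m$ and $|i-j|\le m$, and $d_{ij}=0$ otherwise (the diamond ASM $D_n$). The hollowed-diamond ASM $D^*_{4k+2}$ is obtained from $D$ by setting to $0$ every entry in position $(i,j)$ with $\{i,j\}\subseteq\{k+2t,k+2t+1\}$ for some $t\in\{1,\dots,k\}$. *)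

theory Defs
  imports Complex_Main "Jordan_Normal_Form.Matrix"
begin

text \<open>
  Matrices have type \<^typ>\<open>int mat\<close>, whose rows and columns are indexed from 0. The vertices of a
  graph and the row and column numbers in the formulas for the diamond matrices run from 1 to n,
  so the entry in row i and column j is the matrix entry at index (i - 1, j - 1).
\<close>

definition nonzero_entries :: "int vec \<Rightarrow> int list" where
  "nonzero_entries v = filter (\<lambda>x. x \<noteq> 0) (list_of_vec v)"

text \<open>A line of an ASM has a first and a last nonzero entry; in particular it is not zero.\<close>

definition alternating_line :: "int vec \<Rightarrow> bool" where
  "alternating_line v \<longleftrightarrow>
     (let xs = nonzero_entries v in
        xs \<noteq> [] \<and> hd xs = 1 \<and> last xs = 1 \<and>
        (\<forall>p. Suc p < length xs \<longrightarrow> sgn (xs ! Suc p) = - sgn (xs ! p)))"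

definition alternating_sign_matrix :: "nat \<Rightarrow> int mat \<Rightarrow> bool" where
  "alternating_sign_matrix n A \<longleftrightarrow>
     A \<in> carrier_mat n n \<and>
     (\<forall>i<n. \<forall>j<n. A $$ (i, j) \<in> {0, 1, -1}) \<and>
     (\<forall>i<n. alternating_line (row A i)) \<and>
     (\<forall>j<n. alternating_line (col A j))"

definition symmetric_hollow_asm :: "nat \<Rightarrow> int mat \<Rightarrow> bool" where
  "symmetric_hollow_asm n A \<longleftrightarrow>
     alternating_sign_matrix n A \<and> transpose_mat A = A \<and> (\<forall>i<n. A $$ (i, i) = 0)"

definition num_nonzero :: "int mat \<Rightarrow> nat" where
  "num_nonzero A = card {(i, j). i < dim_row A \<and> j < dim_col A \<and> A $$ (i, j) \<noteq> 0}"

text \<open>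
  A signed graph is a set of edges together with a sign function, of which only the values on
  edges matter.
\<close>

definition loopless_signed_graph :: "nat \<Rightarrow> nat set set \<Rightarrow> (nat set \<Rightarrow> int) \<Rightarrow> bool" where
  "loopless_signed_graph n E \<sigma> \<longleftrightarrow>
     (\<forall>e\<in>E. e \<subseteq> {1..n} \<and> card e = 2) \<and> (\<forall>e\<in>E. \<sigma> e \<in> {1, -1})"

definition signed_adjacency_mat :: "nat \<Rightarrow> nat set set \<Rightarrow> (nat set \<Rightarrow> int) \<Rightarrow> int mat" where
  "signed_adjacency_mat n E \<sigma> =
     mat n n (\<lambda>(p, q). if {Suc p, Suc q} \<in> E then \<sigma> {Suc p, Suc q} else 0)"

definition loopless_alternating_signed_graph ::
    "nat \<Rightarrow> nat set set \<Rightarrow> (nat set \<Rightarrow> int) \<Rightarrow> bool" where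
  "loopless_alternating_signed_graph n E \<sigma> \<longleftrightarrow>
     loopless_signed_graph n E \<sigma> \<and> symmetric_hollow_asm n (signed_adjacency_mat n E \<sigma>)"

text \<open>The exponent is a natural number subtraction that is exact, since i + j is at least m + 2 there.\<close>

definition diamond :: "nat \<Rightarrow> int mat" where
  "diamond k =
     (let n = 4 * k + 2; m = 2 * k + 1 in
        mat n n (\<lambda>(p, q). let i = Suc p; j = Suc q in
          if m + 2 \<le> i + j \<and> i + j \<le> 3 * m \<and> \<bar>int i - int j\<bar> \<le> int m
          then (-1) ^ (i + j - m - 2) else 0))"

definition hollowed_diamond :: "nat \<Rightarrow> int mat" where
  "hollowed_diamond k =
     (let n = 4 * k + 2 in
        mat n n (\<lambda>(p, q). let i = Suc p; j = Suc q in
          if \<exists>t\<in>{1..k}. {i, j} \<subseteq> {k + 2 * t, k + 2 * t + 1} then 0 else diamond k $$ (p, q)))"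

end

theory Submission
  imports Defs
begin

text \<open>
  Call (i, j) a carry if the sums of column j over the first i - 1 rows and over the first i rows
  are both 1. Row i contains 2 i - 1 nonzero entries minus twice its number of carries, so one has
  to show that the first m = n / 2 rows contain at least k carries; rotating the matrix by a half
  turn gives the same for the remaining rows.

  A symmetric matrix with zero diagonal has even leading corner sums. Each time such a corner sum
  grows, at row i, the position (i, i) is a carry, and, unless i = m, so is one of (i - 1, i),
  (i + 1, i), (i + 1, i - 1). If the leading corner sum of order m is small, then row m has many
  column sums equal to 1 to the right of the diagonal, which forces carries there.

  If there are exactly k carries in the upper half, then there are no others than those just
  described. A column sum equal to 1 that is not carried moves outwards from one row to the next,
  and this bounds all the corner sums from below and from above until nothing is left undetermined.
  One half alone does not suffice: the upper half forces a 1 in the last entry of the m-th row of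
  column sums, and the half turn turns this into a 0 in the first entry, which the upper bounds
  need.
\<close>

text \<open>
  Indices run from 1 to n, and the entries outside that range are 0.
\<close>

locale hollow_asm =
  fixes k m n :: nat and a :: "nat \<Rightarrow> nat \<Rightarrow> int"
  assumes m_eq: "m = 2 * k + 1" and n_eq: "n = 2 * m"
    and sym: "a i j = a j i"
    and diag: "a i i = 0"
    and supp: "i = 0 \<or> n < i \<Longrightarrow> a i j = 0"
    and prefix: "(\<Sum>r=1..i. a r j) \<in> {0, 1}"
    and total: "1 \<le> j \<Longrightarrow> j \<le> n \<Longrightarrow> (\<Sum>r=1..n. a r j) = 1"
begin

section \<open>Column sums and corner sums\<close>

definition col_sum :: "nat \<Rightarrow> nat \<Rightarrow> int" where
  "col_sum i j = (\<Sum>r=1..i. a r j)"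

definition corner_sum :: "nat \<Rightarrow> nat \<Rightarrow> int" where
  "corner_sum i j = (\<Sum>l=1..j. col_sum i l)"

lemma col_sum_cases: "col_sum i j = 0 \<or> col_sum i j = 1"
  using prefix[where i = i and j = j] by (auto simp: col_sum_def)

lemma col_sum_nonneg: "0 \<le> col_sum i j" and col_sum_le1: "col_sum i j \<le> 1"
  using col_sum_cases[of i j] by auto

lemma col_sum_0 [simp]: "col_sum 0 j = 0"
  by (simp add: col_sum_def)

lemma col_sum_step: "1 \<le> i \<Longrightarrow> col_sum i j = col_sum (i - 1) j + a i j"
  by (cases i) (auto simp: col_sum_def)

lemma col_sum_out: "j = 0 \<or> n < j \<Longrightarrow> col_sum i j = 0"
  unfolding col_sum_def using supp sym by (metis (no_types, lifting) sum.neutral)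

lemma col_sum_n: "1 \<le> j \<Longrightarrow> j \<le> n \<Longrightarrow> col_sum n j = 1"
  unfolding col_sum_def by (rule total)

lemma corner_sum_0 [simp]: "corner_sum i 0 = 0" "corner_sum 0 j = 0"
  by (auto simp: corner_sum_def)

lemma corner_sum_step: "1 \<le> j \<Longrightarrow> corner_sum i j = corner_sum i (j - 1) + col_sum i j"
  by (cases j) (auto simp: corner_sum_def)

lemma corner_sum_sym: "corner_sum i j = corner_sum j i"
proof -
  have "corner_sum i j = (\<Sum>r=1..i. \<Sum>l=1..j. a r l)"
    unfolding corner_sum_def col_sum_def by (rule sum.swap)
  also have "\<dots> = corner_sum j i"
    unfolding corner_sum_def col_sum_def using sym by (intro sum.cong) auto
  finally show ?thesis .
qed

lemma corner_sum_row: "1 \<le> i \<Longrightarrow> corner_sum i j = corner_sum (i - 1) j + col_sum j i"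
  using corner_sum_step[of i j] corner_sum_sym by simp

lemma corner_sum_n: "i \<le> n \<Longrightarrow> corner_sum i n = int i"
proof -
  assume "i \<le> n"
  then have "corner_sum n i = (\<Sum>l=1..i. 1)"
    unfolding corner_sum_def by (intro sum.cong) (auto simp: col_sum_n)
  then show ?thesis using corner_sum_sym by simp
qed

lemma corner_sum_beyond: "n \<le> j \<Longrightarrow> i \<le> n \<Longrightarrow> corner_sum i j = int i"
proof (induction j rule: dec_induct)
  case base then show ?case by (simp add: corner_sum_n)
next
  case (step j) then show ?case using corner_sum_step[of "Suc j" i] col_sum_out[of "Suc j"] by simp
qed

lemma corner_sum_nonneg: "0 \<le> corner_sum i j"
  unfolding corner_sum_def using col_sum_nonneg by (simp add: sum_nonneg)

lemma corner_sum_mono: "j \<le> j' \<Longrightarrow> corner_sum i j \<le> corner_sum i j'"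
proof (induction j' rule: dec_induct)
  case (step j') then show ?case
    using corner_sum_step[of "Suc j'" i] col_sum_nonneg[of i "Suc j'"] by simp
qed simp

lemma col_sum_diag: "1 \<le> i \<Longrightarrow> col_sum (i - 1) i = col_sum i i"
  using col_sum_step[of i i] diag[of i] by simp

text \<open>The row and the column added to the leading block contribute equally, because their
  common entry is 0. This is the source of the evenness of leading corner sums.\<close>

lemma corner_sum_diag: "1 \<le> i \<Longrightarrow> corner_sum i i = corner_sum (i - 1) (i - 1) + 2 * col_sum i i"
  using corner_sum_row[of i i] corner_sum_step[of i "i - 1"] col_sum_diag[of i] by simp

lemma corner_sum_diag_sum: "corner_sum i i = 2 * (\<Sum>r=1..i. col_sum r r)"
  by (induction i) (use corner_sum_diag in auto)

section \<open>Carries near the diagonal and to the right of it\<close>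

definition carry :: "nat \<Rightarrow> nat \<Rightarrow> bool" where
  "carry i j \<longleftrightarrow> 1 \<le> i \<and> col_sum (i - 1) j = 1 \<and> col_sum i j = 1"

lemma carry_range: "carry i j \<Longrightarrow> 2 \<le> i \<and> 1 \<le> j \<and> j \<le> n"
  using col_sum_out[of j i] col_sum_0[of j] unfolding carry_def
  by (metis One_nat_def Suc_1 col_sum_0 diff_Suc_1' le_antisym not_less not_less_eq_eq zero_neq_one le_zero_eq)

text \<open>If neither one is carried, both come from entries 1 in row i. By symmetry these are
  consecutive entries of column i, whose partial sum would jump by 2.\<close>

lemma not_two_pos:
  assumes "1 \<le> j" "col_sum i j = 1" "col_sum i (j + 1) = 1" "1 \<le> i"
  shows "carry i j \<or> carry i (j + 1)"
proof (rule ccontr)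
  assume "\<not> ?thesis"
  then have "col_sum (i-1) j = 0" "col_sum (i-1) (j+1) = 0"
    using assms col_sum_cases by (auto simp: carry_def)
  then have "a i j = 1" "a i (j+1) = 1" using assms col_sum_step by simp_all
  then have "col_sum (j+1) i = col_sum (j-1) i + 2"
    using col_sum_step[of j i] col_sum_step[of "j+1" i] sym assms(1) by simp
  then show False using col_sum_cases[of "j+1" i] col_sum_cases[of "j-1" i] by auto
qed

lemma not_two_neg:
  assumes "1 \<le> j" "col_sum (i - 1) j = 1" "col_sum (i - 1) (j + 1) = 1" "1 \<le> i"
  shows "carry i j \<or> carry i (j + 1)"
proof (rule ccontr)
  assume "\<not> ?thesis"
  then have "col_sum i j = 0" "col_sum i (j+1) = 0"
    using assms col_sum_cases by (auto simp: carry_def)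
  then have "a i j = -1" "a i (j+1) = -1"
    using assms col_sum_step[of i j] col_sum_step[of i "j+1"] by simp_all
  then have "col_sum (j+1) i = col_sum (j-1) i - 2"
    using col_sum_step[of j i] col_sum_step[of "j+1" i] sym[of i] assms(1) by simp
  then show False using col_sum_cases[of "j+1" i] col_sum_cases[of "j-1" i] by auto
qed

text \<open>If (i - 1, i) is not a carry, then row i - 1 has a 1 in column i, so by symmetry row i
  has a 1 in column i - 1. Row i of column sums now has ones at i - 1 and i, and row i + 1 cannot
  cancel both.\<close>

lemma carry_beside_diag:
  assumes "1 \<le> i" "col_sum i i = 1"
  shows "carry (i - 1) i \<or> carry (i + 1) i \<or> carry (i + 1) (i - 1)"
proof (cases "carry (i - 1) i")
  case False
  have ci: "col_sum (i - 1) i = 1" using assms col_sum_diag by simp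
  then have i2: "2 \<le> i" using assms(1) by (cases "i = 1") auto
  then have "col_sum (i - 1 - 1) i = 0" using False ci col_sum_cases[of "i-1-1" i]
    by (auto simp: carry_def)
  then have "a (i - 1) i = 1" using col_sum_step[of "i - 1" i] ci i2 by simp
  then have "a i (i - 1) = 1" using sym by simp
  then have "col_sum i (i - 1) = 1"
    using col_sum_step[of i "i - 1"] assms(1) col_sum_nonneg[of "i-1" "i-1"]
      col_sum_le1[of i "i-1"] by simp
  then show ?thesis using not_two_neg[of "i - 1" "i + 1"] assms i2 by auto
qed auto

text \<open>To the right of column i, rows i and i - 1 of column sums total i and i - 1 minus the
  corner sums. Each of the n - i columns there contributes at most 1 to both rows together, plus 1
  more if it is carried.\<close>

lemma row_right_carries:
  assumes "1 \<le> i" "i \<le> n"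
  shows "3 * int i - 1 - int n - 2 * corner_sum i i + col_sum i i
    \<le> int (card {j. i < j \<and> carry i j})"
proof -
  have fin: "finite {j. i < j \<and> carry i j}"
    by (rule finite_subset[of _ "{1..n}"]) (use carry_range in auto)
  have split: "corner_sum r i + (\<Sum>j\<in>{i<..n}. col_sum r j) = int r" if "r \<le> n" for r
  proof -
    have "{1..n} = {1..i} \<union> {i<..n}" using assms by auto
    then have "corner_sum r n = corner_sum r i + (\<Sum>j\<in>{i<..n}. col_sum r j)"
      unfolding corner_sum_def by (simp add: sum.union_disjoint ivl_disj_int)
    then show ?thesis using corner_sum_n that by simp
  qed
  have "(\<Sum>j\<in>{i<..n}. col_sum i j + col_sum (i - 1) j - of_bool (carry i j)) \<le> (\<Sum>j\<in>{i<..n}. 1)"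
  proof (rule sum_mono)
    fix j
    show "col_sum i j + col_sum (i - 1) j - of_bool (carry i j) \<le> 1"
      using col_sum_cases[of i j] col_sum_cases[of "i - 1" j] assms by (auto simp: carry_def)
  qed
  then have 1: "(\<Sum>j\<in>{i<..n}. col_sum i j) + (\<Sum>j\<in>{i<..n}. col_sum (i - 1) j)
      - (\<Sum>j\<in>{i<..n}. of_bool (carry i j)) \<le> int n - int i"
    using assms by (simp add: sum.distrib sum_subtractf)
  have 2: "(\<Sum>j\<in>{i<..n}. of_bool (carry i j)) = int (card {j. i < j \<and> carry i j})"
  proof -
    have "(\<Sum>j\<in>{i<..n}. of_bool (carry i j)) = int (card ({i<..n} \<inter> {j. carry i j}))"
      by simp
    also have "{i<..n} \<inter> {j. carry i j} = {j. i < j \<and> carry i j}"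
      using carry_range by auto
    finally show ?thesis .
  qed
  have 3: "corner_sum (i - 1) i = corner_sum i i - col_sum i i"
    using corner_sum_row[of i i] assms by simp
  have "i - 1 \<le> n" using assms by simp
  then show ?thesis using 1 2 3 split[of i] split[of "i - 1"] assms by (simp add: of_nat_diff)
qed

lemma m_pos: "1 \<le> m"
  using m_eq by simp

section \<open>Counting the carries in the upper half\<close>

definition top_carries :: "(nat \<times> nat) set" where
  "top_carries = {(i, j). i \<le> m \<and> carry i j}"

lemma finite_top_carries: "finite top_carries"
  by (rule finite_subset[of _ "{..m} \<times> {..n}"]) (use carry_range in \<open>auto simp: top_carries_def\<close>)

definition diag_rows :: "nat set" where
  "diag_rows = {i\<in>{1..m}. col_sum i i = 1}"

text \<open>Column minus row is 1, -1 or -2 in the three cases, so the position determines i and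
  never lies on the diagonal. The order of preference matters later: a less preferred shape says
  that the preferred ones are not carries.\<close>

definition companion :: "nat \<Rightarrow> nat \<times> nat" where
  "companion i = (if carry (i - 1) i then (i - 1, i)
                else if carry (i + 1) i then (i + 1, i) else (i + 1, i - 1))"

text \<open>The index m is left out of the companions since its companion may lie in row m + 1,
  outside the upper half.\<close>

abbreviation accounted :: "(nat \<times> nat) set" where
  "accounted \<equiv> (\<lambda>i. (i, i)) ` diag_rows \<union> companion ` (diag_rows - {m})"

lemma accounted_subset: "accounted \<subseteq> top_carries"
proof -
  have "companion i \<in> top_carries" if "i \<in> diag_rows - {m}" for i
    using carry_beside_diag[of i] that unfolding companion_def top_carries_def diag_rows_def by auto
  moreover have "(i, i) \<in> top_carries" if "i \<in> diag_rows" for i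
    using col_sum_diag[of i] that unfolding top_carries_def diag_rows_def carry_def by auto
  ultimately show ?thesis by blast
qed

lemma corner_sum_m_card: "corner_sum m m = 2 * int (card diag_rows)"
proof -
  have "(\<Sum>r=1..m. col_sum r r) = (\<Sum>r\<in>{1..m}. of_bool (col_sum r r = 1))"
    by (intro sum.cong refl) (use col_sum_cases in force)
  also have "\<dots> = int (card ({1..m} \<inter> {r. col_sum r r = 1}))" by simp
  also have "{1..m} \<inter> {r. col_sum r r = 1} = diag_rows" by (auto simp: diag_rows_def)
  finally show ?thesis using corner_sum_diag_sum by simp
qed

lemma card_accounted: "int (card accounted) = corner_sum m m - col_sum m m"
proof -
  have fin: "finite diag_rows" by (simp add: diag_rows_def)
  have inj: "inj_on companion (diag_rows - {m})"
    by (rule inj_onI) (auto simp: companion_def diag_rows_def split: if_splits)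
  have disj: "(\<lambda>i. (i, i)) ` diag_rows \<inter> companion ` (diag_rows - {m}) = {}"
    by (auto simp: companion_def diag_rows_def split: if_splits)
  have "card accounted = card diag_rows + card (diag_rows - {m})"
    using fin inj disj by (simp add: card_Un_disjoint card_image inj_on_def)
  moreover have "int (card (diag_rows - {m})) = int (card diag_rows) - col_sum m m"
  proof (cases "col_sum m m = 1")
    case True
    then have "m \<in> diag_rows" using m_pos by (simp add: diag_rows_def)
    then show ?thesis using True fin card_gt_0_iff[of diag_rows]
      by (auto simp: card_Diff_singleton of_nat_diff Suc_leI)
  next
    case False
    then have "m \<notin> diag_rows" "col_sum m m = 0" using col_sum_cases by (auto simp: diag_rows_def)
    then show ?thesis by simp
  qed
  ultimately show ?thesis using corner_sum_m_card by simp
qed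

definition right_m :: "(nat \<times> nat) set" where
  "right_m = Pair m ` {j. m < j \<and> carry m j}"

lemma card_right_m: "int (card right_m) \<ge> 2 * int k - 2 * corner_sum m m + col_sum m m"
  using row_right_carries[of m] m_eq n_eq unfolding right_m_def
  by (simp add: card_image inj_on_def)

lemma right_m_subset: "right_m \<subseteq> top_carries" and right_m_disjoint: "accounted \<inter> right_m = {}"
  by (auto simp: right_m_def top_carries_def companion_def diag_rows_def split: if_splits)

lemma card_top_ge': "corner_sum m m - col_sum m m + int (card right_m) \<le> int (card top_carries)"
proof -
  have "card (accounted \<union> right_m) \<le> card top_carries"
    using accounted_subset right_m_subset finite_top_carries by (intro card_mono) auto
  moreover have "card (accounted \<union> right_m) = card accounted + card right_m"
    by (intro card_Un_disjoint right_m_disjoint)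
       (use finite_subset[OF accounted_subset finite_top_carries]
          finite_subset[OF right_m_subset finite_top_carries] in auto)
  ultimately show ?thesis using card_accounted by linarith
qed

text \<open>Let L be the leading corner sum of order m and c = \<open>col_sum m m\<close>. The
  accounted carries number L - c, which is at least k if L > k. Adding the bound for
  \<open>right_m\<close> gives 2 k - L, which is at least k if L is at most k.\<close>

lemma card_top_ge: "k \<le> card top_carries"
  using card_top_ge' card_right_m col_sum_cases[of m m] corner_sum_m_card by linarith

text \<open>
  The counting bound leaves a second possibility, the leading corner sum being k while row m adds to
  it; there row m - 1 has one more carry to the right of the diagonal.
\<close>

lemma corner_sum_m_if_tight:
  assumes "card top_carries = k"
  shows "corner_sum m m = int k + col_sum m m"
proof (rule ccontr)
  assume "corner_sum m m \<noteq> int k + col_sum m m"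
  then have Lm: "corner_sum m m = int k" and cm: "col_sum m m = 1"
    using card_top_ge' card_right_m col_sum_cases[of m m] assms corner_sum_m_card by linarith+
  have k: "1 \<le> k" using Lm corner_sum_diag_sum[of m] cm col_sum_0 m_eq by (cases k) auto
  have L1: "corner_sum (m - 1) (m - 1) = int k - 2" using Lm cm corner_sum_diag[of m] m_eq by simp
  \<comment> \<open>For row m - 1 the bound evaluates to 1 +
    \<open>col_sum (m - 1) (m - 1)\<close>.\<close>
  have "int (card {j. m - 1 < j \<and> carry (m - 1) j}) \<ge> 1"
    using row_right_carries[of "m - 1"] L1 col_sum_nonneg[of "m-1" "m-1"] k m_eq n_eq by simp
  then have "{j. m - 1 < j \<and> carry (m - 1) j} \<noteq> {}"
    by (metis card.empty int_ops(1) not_one_le_zero)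
  then obtain j where j: "m - 1 < j" "carry (m - 1) j" by auto
  let ?X = "insert (m - 1, j) (accounted \<union> right_m)"
  \<comment> \<open>The position (m - 1, m) could only be the companion of m, which is left
    out.\<close>
  have notin: "(m - 1, j) \<notin> accounted \<union> right_m"
    using j m_pos by (auto simp: right_m_def companion_def diag_rows_def split: if_splits)
  have "?X \<subseteq> top_carries"
    using accounted_subset right_m_subset j by (auto simp: top_carries_def)
  then have "card ?X \<le> k" using card_mono[OF finite_top_carries] assms by metis
  moreover have "card ?X = Suc (card accounted + card right_m)"
    using notin right_m_disjoint finite_subset[OF accounted_subset finite_top_carries]
      finite_subset[OF right_m_subset finite_top_carries]
    by (subst card_insert_disjoint) (auto intro!: card_Un_disjoint)
  moreover have "int (card accounted) = int k - 1" using card_accounted Lm cm by simp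
  ultimately show False using card_right_m Lm cm by linarith
qed

lemma top_carries_if_tight:
  assumes "card top_carries = k"
  shows "top_carries = accounted"
proof -
  have "card accounted = k" using card_accounted corner_sum_m_if_tight[OF assms] by simp
  then show ?thesis using card_subset_eq[OF finite_top_carries accounted_subset] assms by simp
qed

section \<open>Comparing corner sums of consecutive rows\<close>

lemma chain_down:
  assumes "1 \<le> j" "\<not> carry (i + 1) j"
  shows "corner_sum i j \<le> corner_sum (i + 1) (j - 1)"
  \<comment> \<open>Right side minus left side is
    \<open>col_sum j (i + 1) - col_sum (i + 1) j\<close> and also
    \<open>col_sum (j - 1) (i + 1) - col_sum i j\<close>. Without a carry one of the two subtracted
    terms is 0.\<close>
  using corner_sum_step[OF assms(1), of i] corner_sum_step[OF assms(1), of "i + 1"]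
    corner_sum_row[of "i + 1" j]
    corner_sum_row[of "i + 1" "j - 1"] col_sum_cases[of i j] col_sum_cases[of "i + 1" j]
      col_sum_nonneg[of j "i + 1"]
    col_sum_nonneg[of "j - 1" "i + 1"] assms(2)
  by (auto simp: carry_def)

text \<open>The increase is \<open>col_sum i j + col_sum j (i + 1)\<close> and also
  \<open>col_sum (i + 1) j + col_sum (j - 1) (i + 1)\<close>. Without a carry one of the first
  summands is 0.\<close>

lemma chain_up:
  assumes "1 \<le> j" "\<not> carry (i + 1) j"
  shows "corner_sum (i + 1) j \<le> corner_sum i (j - 1) + 1"
  using corner_sum_step[OF assms(1), of i] corner_sum_step[OF assms(1), of "i + 1"]
    corner_sum_row[of "i + 1" j]
    corner_sum_row[of "i + 1" "j - 1"] col_sum_cases[of i j] col_sum_cases[of "i + 1" j]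
      col_sum_le1[of j "i + 1"]
    col_sum_le1[of "j - 1" "i + 1"] assms(2)
  by (auto simp: carry_def)

text \<open>Cut the 2 u columns after j into pairs; each pair holds at most one 1.\<close>

lemma sparse_row:
  assumes "\<And>l. j < l \<Longrightarrow> l < j + 2 * u \<Longrightarrow> col_sum i l = 1 \<Longrightarrow> col_sum i (l + 1) = 0"
  shows "corner_sum i (j + 2 * u) \<le> corner_sum i j + int u"
  using assms
proof (induction u)
  case (Suc u)
  have "corner_sum i (j + 2 * u) \<le> corner_sum i j + int u" using Suc by simp
  moreover have "col_sum i (j + 2 * u + 1) + col_sum i (j + 2 * u + 2) \<le> 1"
    using Suc.prems[of "j + 2 * u + 1"] col_sum_cases[of i "j + 2 * u + 1"]
      col_sum_le1[of i "j + 2 * u + 2"]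
    by auto
  moreover have
    "corner_sum i (j + 2 * Suc u) = corner_sum i (j + 2 * u) + col_sum i (j + 2 * u + 1)
      + col_sum i (j + 2 * u + 2)"
    using corner_sum_step[of "j + 2 * u + 1" i] corner_sum_step[of "j + 2 * u + 2" i] by simp
  ultimately show ?case by simp
qed simp

end

subsection \<open>Upper halves with the fewest carries\<close>

locale tight_hollow_asm = hollow_asm +
  assumes tight: "card top_carries = k"
begin

text \<open>By tightness every carry in the upper half is accounted for, so it is diagonal or has
  one of the three companion shapes, here expressed through its own row i. The negated carries come
  from the order of preference, and j < m from leaving out m.\<close>

lemma carry_cases:
  assumes "carry i j" "i \<le> m"
  obtains "j = i" "col_sum i i = 1"
  | "j = i + 1" "j < m" "col_sum j j = 1"
  | "2 \<le> i" "j = i - 1" "col_sum j j = 1" "\<not> carry (i - 2) (i - 1)"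
  | "2 \<le> i" "j = i - 2" "col_sum (i - 1) (i - 1) = 1" "\<not> carry (i - 2) (i - 1)" "\<not> carry i (i - 1)"
proof -
  have "(i, j) \<in> accounted"
    using assms top_carries_if_tight[OF tight] by (auto simp: top_carries_def)
  then consider "j = i" "col_sum i i = 1"
    | r where "r \<in> diag_rows - {m}" "(i, j) = companion r"
    by (auto simp: diag_rows_def)
  then show thesis
  proof cases
    case 1 then show thesis using that(1) by simp
  next
    case 2 then show thesis using that(2-4) unfolding companion_def diag_rows_def
      by (auto split: if_splits)
  qed
qed

lemma no_right_adjacent:
  assumes "1 \<le> i" "i \<le> m" "i + 1 < j" "col_sum i j = 1"
  shows "col_sum i (j + 1) = 0"
proof (rule ccontr)
  assume "col_sum i (j + 1) \<noteq> 0"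
  then have "carry i j \<or> carry i (j + 1)" using not_two_pos[of j i] assms col_sum_cases by auto
  then show False using assms by (auto elim!: carry_cases)
qed



text \<open>The entry can only be -1, so row i - 1 of column sums has ones in columns i and i + 1.
  One of them is carried, and no carry of a tight upper half lies two places right of the
  diagonal.\<close>

lemma neg_next_to_diag:
  assumes "1 \<le> i" "i \<le> m" "col_sum i i = 1" "a i (i + 1) \<noteq> 0"
  shows "carry (i - 1) i"
proof -
  have "col_sum (i + 1) i = col_sum i i + a i (i + 1)" using col_sum_step[of "i + 1" i] sym by simp
  then have "a i (i + 1) = -1" using assms col_sum_cases[of "i + 1" i] by auto
  then have "col_sum (i - 1) (i + 1) = 1"
    using col_sum_step[of i "i + 1"] assms(1) col_sum_cases[of i "i+1"]
      col_sum_cases[of "i-1" "i+1"] by auto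
  moreover have "col_sum (i - 1) i = 1" using assms col_sum_diag by simp
  moreover from this have "1 \<le> i - 1" by (cases "i = 1") (use assms in auto)
  ultimately have "carry (i - 1) i \<or> carry (i - 1) (i + 1)"
    using not_two_pos[of i "i - 1"] assms by auto
  moreover have "\<not> carry (i - 1) (i + 1)"
  proof
    assume "carry (i - 1) (i + 1)"
    then show False by (rule carry_cases) (use assms in auto)
  qed
  ultimately show ?thesis by simp
qed

text \<open>The last shape cannot occur: there (i, i - 1) is not a carry, so the entry is -1. By
  symmetry \<open>neg_next_to_diag\<close> makes (i - 2, i - 1) a carry, and the first shape would
  have been preferred.\<close>

lemma carry_cases':
  assumes "carry i j" "i \<le> m"
  obtains "j = i" "col_sum i i = 1"
  | "j = i + 1" "j < m" "col_sum j j = 1"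
  | "2 \<le> i" "j = i - 1" "col_sum j j = 1" "\<not> carry (i - 2) (i - 1)"
  using assms
proof (cases rule: carry_cases)
  case 4
  have "col_sum i (i - 1) = 0" using 4 col_sum_cases[of i "i-1"] by (auto simp: carry_def)
  then have "a i (i - 1) = -1" using 4 col_sum_step[of i "i - 1"] by simp
  then have "a (i - 1) (i - 1 + 1) \<noteq> 0" using 4 sym by simp
  then have "carry (i - 1 - 1) (i - 1)" using 4 assms by (intro neg_next_to_diag) auto
  then show thesis using 4 by (simp add: numeral_2_eq_2)
qed (use that in auto)

text \<open>The entry (i, i + 1) is 0 by \<open>neg_next_to_diag\<close>. Hence column i still has
  sum 1 after row i + 1 and its next entry is not 1; by symmetry a 1 among the column sums at (i, i
  + 2) would be a carry, which is excluded there.\<close>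

lemma zeros_after_diag:
  assumes "1 \<le> i" "i \<le> m" "col_sum i i = 1" "\<not> carry (i - 1) i" "\<not> carry i (i + 1)"
  shows "col_sum i (i + 1) = 0" "col_sum i (i + 2) = 0"
proof -
  have a1: "a i (i + 1) = 0" using neg_next_to_diag assms by auto
  then show "col_sum i (i + 1) = 0"
    using assms col_sum_step[of i "i + 1"] col_sum_cases[of i "i + 1"] by (auto simp: carry_def)
  have "col_sum (i + 2) i = col_sum i i + a i (i + 1) + a i (i + 2)"
    using col_sum_step[of "i + 1" i] col_sum_step[of "i + 2" i] sym by simp
  then have "a i (i + 2) \<noteq> 1" using a1 assms col_sum_le1[of "i + 2" i] by auto
  moreover have "\<not> carry i (i + 2)"
  proof
    assume "carry i (i + 2)"
    then show False by (rule carry_cases) (use assms in auto)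
  qed
  ultimately show "col_sum i (i + 2) = 0"
    using assms col_sum_step[of i "i + 2"] col_sum_cases[of i "i + 2"]
      col_sum_cases[of "i - 1" "i + 2"]
    by (auto simp: carry_def)
qed

lemma no_carry_right_of_m: "m < j \<Longrightarrow> \<not> carry m j"
  by (auto elim!: carry_cases)

lemma row_m_sparse: "m < j \<Longrightarrow> col_sum m j = 1 \<Longrightarrow> col_sum m (j + 1) = 0"
  using not_two_pos[of j m] no_carry_right_of_m[of j] no_carry_right_of_m[of "j + 1"]
    col_sum_cases[of m "j + 1"] m_pos by auto

text \<open>If \<open>col_sum m m\<close> is 1, the two columns after m have sum 0; otherwise the
  corner sum of order m is k and at most one of these columns adds to it.\<close>

lemma row_m_start: "corner_sum m (m + 1) \<le> int k + 1" "corner_sum m (m + 2) \<le> int k + 1"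
proof -
  have Lm: "corner_sum m m = int k + col_sum m m" using corner_sum_m_if_tight[OF tight] .
  have s: "corner_sum m (m + 1) = corner_sum m m + col_sum m (m + 1)"
    "corner_sum m (m + 2) = corner_sum m (m + 1) + col_sum m (m + 2)"
    using corner_sum_step[of "m + 1" m] corner_sum_step[of "m + 2" m] by simp_all
  have "col_sum m (m + 1) + col_sum m (m + 2) \<le> 1"
    using row_m_sparse[of "m + 1"] col_sum_cases[of m "m+1"] col_sum_le1[of m "m+2"] by auto
  moreover have "col_sum m (m + 1) = 0 \<and> col_sum m (m + 2) = 0" if "col_sum m m = 1"
  proof -
    have "\<not> carry (m - 1) m" using m_pos by (auto elim!: carry_cases)
    then show ?thesis
      using zeros_after_diag[of m] that m_pos no_carry_right_of_m[of "m+1"] by auto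
  qed
  ultimately show "corner_sum m (m + 1) \<le> int k + 1" "corner_sum m (m + 2) \<le> int k + 1"
    using Lm s col_sum_cases[of m m] col_sum_nonneg[of m "m+2"] by auto
qed

lemma corner_sum_m_upper:
  assumes "m < j"
  shows "2 * corner_sum m j \<le> int j"
proof -
  define u where "u = (j - m - 1) div 2"
  have "j = m + 1 + 2 * u \<or> j = m + 2 + 2 * u" using assms unfolding u_def by presburger
  then show ?thesis
    using sparse_row[of "m + 1" u m] sparse_row[of "m + 2" u m] row_m_sparse row_m_start m_eq
    by force
qed

text \<open>Row m of column sums totals m, while \<open>corner_sum_m_upper\<close> at n - 1 allows
  less than m before the last column. For k = 0 that bound does not reach n - 1 = m, and the corner
  sum is computed directly.\<close>

lemma last_column_m: "col_sum m n = 1"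
proof (rule ccontr)
  assume "\<not> ?thesis"
  then have "corner_sum m (n - 1) = int m"
    using corner_sum_step[of n m] col_sum_cases[of m n] corner_sum_n[of m] n_eq m_pos by simp
  moreover have "corner_sum m (n - 1) < int m" if "k \<noteq> 0"
    using corner_sum_m_upper[of "n - 1"] that n_eq m_eq by simp
  moreover have "corner_sum m (n - 1) = 0" if "k = 0"
    using that n_eq m_eq corner_sum_m_if_tight[OF tight] col_sum_diag[of 1] by simp
  ultimately show False using m_pos by (cases "k = 0") auto
qed

text \<open>Downward induction from row m: the base counts back from the right end, where the corner
  sum is m, and \<open>chain_up\<close> passes from (i + 1, j + 1) to (i, j).\<close>

lemma corner_sum_lower:
  assumes "i \<le> m" "i < j" "j \<le> m + i + 1"
  shows "int i + int j - int m - 1 \<le> 2 * corner_sum i j"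
  using assms
proof (induction i arbitrary: j rule: inc_induct)
  case base
  define u where "u = (2 * m + 1 - j) div 2"
  \<comment> \<open>Steps of two columns end at n + 1 rather than n when j is odd; the corner sum of
    row m is m at both.\<close>
  have u: "j + 2 * u = n \<or> j + 2 * u = n + 1" using base n_eq unfolding u_def by presburger
  then have "corner_sum m (j + 2 * u) = int m" using corner_sum_beyond[of "j + 2 * u" m] n_eq
    by auto
  moreover have "corner_sum m (j + 2 * u) \<le> corner_sum m j + int u"
    using base row_m_sparse by (intro sparse_row) auto
  ultimately show ?case using u n_eq by auto
next
  case (step i)
  show ?case
  proof (cases "carry (i + 1) (j + 1)")
    case False
    then show ?thesis using step.IH[of "j + 1"] step.prems chain_up[of "j + 1" i] by simp
  next
    case True
    then have j: "j = i + 1" and "i + 2 < m"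
      by (rule carry_cases; use step in simp)+
    \<comment> \<open>The carry blocks the step from (i + 1, i + 2). Row i has column sum 1 at i + 2
      and 0 at i + 3, so the bound at (i, i + 3), reached from (i + 1, i + 4), yields the one at (i,
      i + 1) after subtracting 1.\<close>
    have ci: "col_sum i (i + 2) = 1" using True j by (simp add: carry_def)
    then have "col_sum i (i + 3) = 0" using no_right_adjacent[of i "i + 2"] step.hyps
      by (cases i) (auto simp: add_ac numeral_3_eq_3)
    then have "corner_sum i (i + 3) = corner_sum i (i + 1) + 1"
      using ci corner_sum_step[of "i + 2" i] corner_sum_step[of "i + 3" i]
        by (simp add: numeral_3_eq_3)
    moreover have "\<not> carry (i + 1) (i + 4)"
    proof
      assume "carry (i + 1) (i + 4)"
      then show False by (rule carry_cases) (use step in auto)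
    qed
    ultimately show ?thesis
      using step.IH[of "i + 4"] \<open>i + 2 < m\<close> chain_up[of "i + 4" i] j by (simp add: numeral_eq_Suc)
  qed
qed

lemma corner_sum_diag_lower: "i \<le> m \<Longrightarrow> int i - int k - 1 \<le> corner_sum i i"
  using corner_sum_lower[of i "i + 1"] corner_sum_step[of "i + 1" i] col_sum_le1[of i "i + 1"]
    m_eq by simp

end

section \<open>Exact corner sums in the upper half\<close>

locale extremal_hollow_asm = tight_hollow_asm +
  assumes first_column_m: "col_sum m 1 = 0"
begin

text \<open>Carries in the upper half lie at most one place left of the diagonal, so in this region
  row m has no adjacent ones and \<open>chain_down\<close> carries the bound upwards.\<close>

lemma corner_sum_upper_left:
  assumes "i \<le> m" "j + 2 \<le> i" "m \<le> i + j"
  shows "2 * corner_sum i j \<le> int i + int j - int m"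
  using assms
proof (induction i arbitrary: j rule: inc_induct)
  case base
  have adj: "col_sum m (l + 1) = 0" if "col_sum m l = 1" "1 \<le> l" "l < j" for l
  proof (rule ccontr)
    assume "col_sum m (l + 1) \<noteq> 0"
    then have "carry m l \<or> carry m (l + 1)" using not_two_pos[of l m] that col_sum_cases m_pos
      by auto
    then show False by (auto elim!: carry_cases') (use that base in auto)
  qed
  \<comment> \<open>For odd j the pairing starts after column 1, which must contribute
    nothing.\<close>
  have L1: "corner_sum m 1 = 0" using first_column_m corner_sum_step[of 1 m] by simp
  define u where "u = j div 2"
  have "j = 0 + 2 * u \<or> j = 1 + 2 * u" unfolding u_def by presburger
  then show ?case
  proof
    assume "j = 0 + 2 * u"
    then show ?thesis using sparse_row[of 0 u m] adj by simp
  next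
    assume "j = 1 + 2 * u"
    then show ?thesis using sparse_row[of 1 u m] adj L1 by simp
  qed
next
  case (step i)
  show ?case
  proof (cases "j = 0")
    case False
    have "\<not> carry (i + 1) j"
    proof
      assume "carry (i + 1) j"
      then show False by (rule carry_cases') (use step in auto)
    qed
    then show ?thesis using step.IH[of "j - 1"] step.prems chain_down[of j i] False
      by (simp add: of_nat_diff)
  qed (use step in auto)
qed

lemma corner_sum_diag_even: "even (corner_sum i i)"
  using corner_sum_diag_sum by simp

text \<open>In the downward induction the claim says that exactly one of the diagonal column sums at
  i and i + 1 is 1. Two ones push the corner sum of order i - 1 below its lower bound; two zeros
  contradict evenness at i = k + 1 and the upper bound left of the diagonal elsewhere.\<close>

lemma corner_sum_diag_eq:
  assumes "i \<le> m" "k + 1 \<le> i"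
  shows "corner_sum i i = int i - int k - 1 + col_sum i i"
  using assms
proof (induction i rule: inc_induct)
  case base
  then show ?case using corner_sum_m_if_tight[OF tight] m_eq by simp
next
  case (step i)
  have corner_sum: "corner_sum (i + 1) (i + 1) = int i - int k + col_sum (i + 1) (i + 1)"
    using step by simp
  have Li: "corner_sum i i = int i - int k - col_sum (i + 1) (i + 1)"
    using corner_sum_diag[of "i + 1"] corner_sum by simp
  show ?case
  proof (cases "col_sum (i + 1) (i + 1) = 1")
    case True
    have "corner_sum (i - 1) (i - 1) = int i - int k - 1 - 2 * col_sum i i"
      using corner_sum_diag[of i] Li True step.prems by simp
    moreover have "i - 1 \<le> m" using step.hyps by simp
    ultimately have "col_sum i i = 0"
      using corner_sum_diag_lower[of "i - 1"] col_sum_cases[of i i] step.prems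
        by (auto simp: of_nat_diff)
    then show ?thesis using Li True by simp
  next
    case False
    then have s: "col_sum (i + 1) (i + 1) = 0" using col_sum_cases by blast
    have "col_sum i i = 1"
    proof (rule ccontr)
      assume "col_sum i i \<noteq> 1"
      then have si: "col_sum i i = 0" using col_sum_cases by blast
      show False
      proof (cases "i = k + 1")
        case True
        then show False using Li s corner_sum_diag_even[of i] by simp
      next
        case False
        have "\<not> carry (i + 1) (i - 1)"
        proof
          assume "carry (i + 1) (i - 1)"
          then show False by (rule carry_cases') (use step in auto)
        qed
        then have "corner_sum i (i - 1) \<le> corner_sum (i + 1) (i - 2)"
          using chain_down[of "i - 1" i] step.prems False by (simp add: numeral_2_eq_2)
        moreover have "2 * corner_sum (i + 1) (i - 2) \<le> int (i + 1) + int (i - 2) - int m"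
          using step False m_eq by (intro corner_sum_upper_left) auto
        ultimately show False
          using corner_sum_step[of i i] si Li s step.prems False m_eq by (simp add: of_nat_diff)
      qed
    qed
    then show ?thesis using Li s by simp
  qed
qed

lemma corner_sum_diag_small: "i \<le> k + 1 \<Longrightarrow> corner_sum i i = 0"
proof -
  assume i: "i \<le> k + 1"
  have "corner_sum (k + 1) (k + 1) = col_sum (k + 1) (k + 1)"
    using corner_sum_diag_eq[of "k + 1"] m_eq by simp
  then have "corner_sum (k + 1) (k + 1) = 0"
    using corner_sum_diag_even[of "k + 1"] col_sum_cases[of "k + 1" "k + 1"] by auto
  moreover have "corner_sum i i \<le> corner_sum (k + 1) (k + 1)"
    using corner_sum_mono[OF i, of i] corner_sum_mono[OF i, of "k + 1"]
      corner_sum_sym[of i "k + 1"] by simp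
  ultimately show ?thesis using corner_sum_nonneg[of i i] by simp
qed

lemma col_sum_diag_consecutive:
  assumes "1 \<le> i" "i < m" "col_sum i i = 1"
  shows "col_sum (i + 1) (i + 1) = 0" "k + 2 \<le> i"
proof -
  show k: "k + 2 \<le> i"
  proof (rule ccontr)
    assume "\<not> ?thesis"
    then have "i \<le> k + 1" "i - 1 \<le> k + 1" by auto
    then show False
      using corner_sum_diag_small[of i] corner_sum_diag_small[of "i - 1"] corner_sum_diag[of i]
        assms by simp
  qed
  show "col_sum (i + 1) (i + 1) = 0"
    using corner_sum_diag_eq[of i] corner_sum_diag_eq[of "i + 1"] corner_sum_diag[of "i + 1"]
      assms k by simp
qed

text \<open>The exact leading corner sums give \<open>col_sum (i - 1) (i - 1) = 1\<close>. The
  corner sum at (i, i - 2) is too small to account for that of order i without a 1 in column i -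
  1.\<close>

lemma carry_below_diag:
  assumes "i \<le> m" "k + 2 \<le> i" "col_sum i i = 0"
  shows "carry i (i - 1)"
proof -
  have Lii: "corner_sum i i = int i - int k - 1" using corner_sum_diag_eq[of i] assms by simp
  then have "col_sum (i - 1) (i - 1) = 1"
    using corner_sum_diag_eq[of "i - 1"] corner_sum_diag[of i] assms by (simp add: of_nat_diff)
  moreover have "col_sum i (i - 1) = 1"
  proof -
    have "2 * corner_sum i (i - 2) \<le> int i + int (i - 2) - int m"
      using assms m_eq by (intro corner_sum_upper_left) auto
    then show ?thesis
      using corner_sum_step[of i i] corner_sum_step[of "i - 1" i] Lii assms m_eq
        col_sum_cases[of i "i - 1"]
      by (auto simp: of_nat_diff numeral_2_eq_2)
  qed
  ultimately show ?thesis using assms by (simp add: carry_def)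
qed

text \<open>A superdiagonal carry (j - 1, j) requires a diagonal 1 at j, so the next diagonal sum is
  0 and (j + 1, j) is a carry as well. That shape is allowed only when (j - 1, j) is not a
  carry.\<close>

lemma carry_le_diag:
  assumes "carry i j" "i \<le> m"
  shows "j \<le> i"
proof (rule ccontr)
  assume "\<not> ?thesis"
  with assms have j: "j = i + 1" "j < m" "col_sum j j = 1" by (auto elim: carry_cases')
  then have "carry (j + 1) (j + 1 - 1)"
    using col_sum_diag_consecutive[of j] by (intro carry_below_diag) auto
  then have "\<not> carry (j + 1 - 2) (j + 1 - 1)"
    by (rule carry_cases') (use j in auto)
  then show False using assms j by simp
qed

text \<open>Downward induction by \<open>chain_down\<close>, unobstructed right of the diagonal by
  \<open>carry_le_diag\<close>. For j = i + 1 and j = i + 2 the step leaves the region j > i, and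
  the exact leading corner sums take over.\<close>

lemma corner_sum_upper:
  assumes "i \<le> m" "i < j" "m \<le> i + j"
  shows "2 * corner_sum i j \<le> int i + int j - int m"
  using assms
proof (induction i arbitrary: j rule: inc_induct)
  case base
  then show ?case using corner_sum_m_upper by simp
next
  case (step i)
  have nc: "\<not> carry (i + 1) j" if "i + 2 \<le> j" for j
    using carry_le_diag[of "i + 1" j] step.hyps that by auto
  have Li: "corner_sum (i + 1) (i + 1) = int i - int k + col_sum (i + 1) (i + 1)" if "k \<le> i"
    using corner_sum_diag_eq[of "i + 1"] step.hyps that by simp
  have Li1: "corner_sum i (i + 1) = int i - int k" if "k \<le> i"
    using corner_sum_row[of "i + 1" "i + 1"] Li that by simp
  consider "j = i + 1" | "j = i + 2" | "i + 3 \<le> j" using step.prems by linarith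
  then show ?case
  proof cases
    case 1
    then show ?thesis using Li1 step.prems m_eq by simp
  next
    case 2
    then have ki: "k \<le> i" using step.prems m_eq by simp
    show ?thesis
    proof (cases "col_sum (i + 1) (i + 1) = 1")
      case True
      then have ci: "col_sum i (i + 1) = 1" using col_sum_diag[of "i + 1"] by simp
      have "col_sum i (i + 2) = 0"
      proof (rule ccontr)
        assume "col_sum i (i + 2) \<noteq> 0"
        then have "carry i (i + 1) \<or> carry i (i + 2)"
          using not_two_pos[of "i + 1" i] ci col_sum_cases[of i "i + 2"] by (cases i) auto
        then show False using carry_le_diag[of i "i + 1"] carry_le_diag[of i "i + 2"] step.hyps
          by auto
      qed
      then show ?thesis using corner_sum_step[of "i + 2" i] Li1 ki 2 m_eq by simp
    next
      case False
      then have "col_sum (i + 1) (i + 1) = 0" using col_sum_cases by blast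
      then show ?thesis using chain_down[of j i] nc[of j] Li ki 2 m_eq by simp
    qed
  next
    case 3
    then have "i + 1 < j - 1" by simp
    then show ?thesis
      using 3 chain_down[of j i] nc[of j] step.IH[of "j - 1"] step.prems by (simp add: of_nat_diff)
  qed
qed

text \<open>Off the diagonal the lower and upper bounds on twice the corner sum differ by 1, which
  leaves the integer quotient. On the diagonal two consecutive values remain and evenness picks
  one.\<close>

definition corner_value :: "nat \<Rightarrow> nat \<Rightarrow> int" where
  "corner_value i j =
     (if i = j then (if i \<le> k + 1 then 0 else 2 * ((int i - int k) div 2))
      else if i + j \<le> m then 0 else if m + i < j then int i
      else (int i + int j - int m) div 2)"

lemma corner_sum_eq_corner_value:
  assumes "i \<le> m" "i \<le> j"
  shows "corner_sum i j = corner_value i j"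
proof -
  consider "i = j" | "i < j" "i + j \<le> m" | "m + i < j" | "i < j" "m < i + j" "j \<le> m + i"
    using assms by linarith
  then show ?thesis
  proof cases
    case 1
    show ?thesis
    proof (cases "i \<le> k + 1")
      case False
      then have "corner_sum i i = int i - int k - 1 + col_sum i i" using corner_sum_diag_eq assms
        by simp
      moreover have "even (corner_sum i i)" by (rule corner_sum_diag_even)
      ultimately have "corner_sum i i = 2 * ((int i - int k) div 2)" using col_sum_cases[of i i]
        by presburger
      then show ?thesis using 1 False by (simp add: corner_value_def)
    qed (use 1 corner_sum_diag_small in \<open>simp add: corner_value_def\<close>)
  next
    case 2
    have "corner_sum i j \<le> corner_sum i (m - i)" using 2 by (intro corner_sum_mono) auto
    moreover have "2 * corner_sum i (m - i) \<le> 0" using corner_sum_upper[of i "m - i"] 2 by simp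
    ultimately have "corner_sum i j = 0" using corner_sum_nonneg[of i j] by simp
    then show ?thesis using 2 by (simp add: corner_value_def)
  next
    case 3
    have "int i \<le> corner_sum i (m + i + 1)" using corner_sum_lower[of i "m + i + 1"] assms by simp
    moreover have "corner_sum i (m + i + 1) \<le> corner_sum i j" using 3
      by (intro corner_sum_mono) auto
    moreover have "corner_sum i j \<le> corner_sum i (max j n)" by (intro corner_sum_mono) auto
    moreover have "corner_sum i (max j n) = int i" using assms n_eq
      by (intro corner_sum_beyond) auto
    ultimately have "corner_sum i j = int i" by simp
    then show ?thesis using 3 m_pos by (simp add: corner_value_def)
  next
    case 4
    then have "corner_sum i j = (int i + int j - int m) div 2"
      using corner_sum_upper[of i j] corner_sum_lower[of i j] assms by simp
    then show ?thesis using 4 by (simp add: corner_value_def)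
  qed
qed

text \<open>An entry is a mixed second difference of corner sums; for i < j all four positions lie
  on or above the diagonal.\<close>

lemma entry_eq:
  assumes "1 \<le> i" "i \<le> m" "i < j"
  shows "a i j = corner_value i j - corner_value (i - 1) j
    - corner_value i (j - 1) + corner_value (i - 1) (j - 1)"
  using assms corner_sum_eq_corner_value[of i j] corner_sum_eq_corner_value[of "i-1" j]
    corner_sum_eq_corner_value[of i "j-1"]
    corner_sum_eq_corner_value[of "i-1" "j-1"] corner_sum_step[of j i] corner_sum_step[of j "i-1"]
      col_sum_step[of i j] by simp

end

subsection \<open>The half turn\<close>

definition rotate_180 :: "nat \<Rightarrow> (nat \<Rightarrow> nat \<Rightarrow> int) \<Rightarrow> nat \<Rightarrow> nat \<Rightarrow> int" where
  "rotate_180 n a i j = a (n + 1 - i) (n + 1 - j)"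

context hollow_asm begin

text \<open>Columns are now summed from the bottom, so within the index range partial sums 0 and 1
  are exchanged.\<close>

lemma sum_rotate:
  assumes "i \<le> n"
  shows "(\<Sum>r=1..i. rotate_180 n a r j) = col_sum n (n + 1 - j) - col_sum (n - i) (n + 1 - j)"
  using assms
proof (induction i)
  case (Suc i)
  then have "col_sum (n - i) (n + 1 - j) = col_sum (n - Suc i) (n + 1 - j) + a (n - i) (n + 1 - j)"
    using col_sum_step[of "n - i" "n + 1 - j"] by simp
  then show ?case using Suc by (simp add: rotate_180_def)
qed simp

lemma hollow_asm_rotate: "hollow_asm k m n (rotate_180 n a)"
proof
  show "m = 2 * k + 1" "n = 2 * m" by (fact m_eq n_eq)+
  show "rotate_180 n a i j = rotate_180 n a j i" "rotate_180 n a i i = 0" for i j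
    using sym diag by (simp_all add: rotate_180_def)
  show supp': "rotate_180 n a i j = 0" if "i = 0 \<or> n < i" for i j
    using that supp by (auto simp: rotate_180_def)
  have small: "(\<Sum>r=1..i. rotate_180 n a r j) \<in> {0, 1}" if "i \<le> n" for i j
  proof (cases "n + 1 - j = 0 \<or> n < n + 1 - j")
    case True
    then show ?thesis using sum_rotate[OF that, of j] col_sum_out by auto
  next
    case False
    then have "col_sum n (n + 1 - j) = 1" by (intro col_sum_n) auto
    then show ?thesis using sum_rotate[OF that, of j] col_sum_cases[of "n - i" "n + 1 - j"] by auto
  qed
  show "(\<Sum>r=1..i. rotate_180 n a r j) \<in> {0, 1}" for i j
  proof (cases "i \<le> n")
    case False
    then have "(\<Sum>r=1..i. rotate_180 n a r j) = (\<Sum>r=1..n. rotate_180 n a r j)"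
      by (intro sum.mono_neutral_right) (auto simp: supp')
    then show ?thesis using small[of n j] by simp
  qed (rule small)
  show "(\<Sum>r=1..n. rotate_180 n a r j) = 1" if "1 \<le> j" "j \<le> n" for j
    using sum_rotate[of n j] that col_sum_n[of "n + 1 - j"] by simp
qed

lemma row_count:
  assumes "1 \<le> i" "i \<le> n"
  shows "int (card {j. a i j \<noteq> 0}) = 2 * int i - 1 - 2 * int (card {j. carry i j})"
proof -
  have out: "a i j = 0" if "j \<notin> {1..n}" for j
    using that supp[of j i] sym[of i j] by auto
  \<comment> \<open>The entry is the difference of two column sums from {0, 1}, hence nonzero
    exactly when one of them is 1.\<close>
  have entry: "of_bool (a i j \<noteq> 0) = col_sum i j + col_sum (i - 1) j - 2 * of_bool (carry i j)"
    for j
    using col_sum_step[of i j] col_sum_cases[of i j] col_sum_cases[of "i - 1" j] assms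
      by (auto simp: carry_def)
  have "int (card {j. a i j \<noteq> 0}) = int (card ({1..n} \<inter> {j. a i j \<noteq> 0}))"
  proof -
    have "{j. a i j \<noteq> 0} = {1..n} \<inter> {j. a i j \<noteq> 0}" using out by blast
    then show ?thesis by simp
  qed
  also have "\<dots> = (\<Sum>j=1..n. of_bool (a i j \<noteq> 0))" by simp
  also have "\<dots> = corner_sum i n + corner_sum (i - 1) n - 2 * (\<Sum>j=1..n. of_bool (carry i j))"
    unfolding entry corner_sum_def by (simp add: sum.distrib sum_subtractf sum_distrib_left)
  also have "(\<Sum>j=1..n. of_bool (carry i j)) = int (card ({1..n} \<inter> {j. carry i j}))" by simp
  also have "{1..n} \<inter> {j. carry i j} = {j. carry i j}" using carry_range by auto
  finally show ?thesis using assms corner_sum_n[of i] corner_sum_n[of "i - 1"]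
    by (simp add: of_nat_diff)
qed

lemma top_count:
  "int (card {(i, j). i \<le> m \<and> a i j \<noteq> 0}) = int m ^ 2 - 2 * int (card top_carries)"
proof -
  have fin: "finite {j. a i j \<noteq> 0}" "finite {j. carry i j}" for i
  proof -
    show "finite {j. a i j \<noteq> 0}"
      by (rule finite_subset[of _ "{..n}"])
        (use supp sym in \<open>metis (mono_tags) atMost_iff mem_Collect_eq not_le subsetI\<close>, simp)
    show "finite {j. carry i j}"
      by (rule finite_subset[of _ "{..n}"]) (use carry_range in auto)
  qed
  have "{(i, j). i \<le> m \<and> a i j \<noteq> 0} = Sigma {1..m} (\<lambda>i. {j. a i j \<noteq> 0})"
    using supp by (auto simp: Suc_le_eq intro!: Nat.gr0I)
  then have 1: "int (card {(i, j). i \<le> m \<and> a i j \<noteq> 0}) = (\<Sum>i=1..m. int (card {j. a i j \<noteq> 0}))"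
    using fin by (simp add: card_SigmaI)
  have "top_carries = Sigma {1..m} (\<lambda>i. {j. carry i j})"
    by (auto simp: top_carries_def carry_def)
  then have 2: "int (card top_carries) = (\<Sum>i=1..m. int (card {j. carry i j}))"
    using fin by (simp add: card_SigmaI)
  have "(\<Sum>i=1..m. int (card {j. a i j \<noteq> 0}))
      = (\<Sum>i=1..m. 2 * int i - 1) - 2 * (\<Sum>i=1..m. int (card {j. carry i j}))"
    using row_count n_eq by (simp add: sum_subtractf sum_distrib_left)
  moreover have "(\<Sum>i=1..m'. 2 * int i - 1) = int m' ^ 2" for m'
    by (induction m') (auto simp: power2_eq_square algebra_simps)
  ultimately show ?thesis using 1 2 by simp
qed

lemma total_count:
  "int (card {(i, j). a i j \<noteq> 0}) = 2 * int m ^ 2 - 2 * int (card top_carries)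
     - 2 * int (card (hollow_asm.top_carries m (rotate_180 n a)))"
proof -
  interpret rot: hollow_asm k m n "rotate_180 n a" by (rule hollow_asm_rotate)
  have range: "1 \<le> i \<and> i \<le> n \<and> 1 \<le> j \<and> j \<le> n" if "a i j \<noteq> 0" for i j
    using that supp[of i j] supp[of j i] sym[of i j]
      by (metis One_nat_def not_le not_less_eq_eq le_zero_eq)
  let ?T = "{(i, j). i \<le> m \<and> a i j \<noteq> 0}" and ?B = "{(i, j). m < i \<and> a i j \<noteq> 0}"
    and ?R = "{(i, j). i \<le> m \<and> rotate_180 n a i j \<noteq> 0}"
  have fin: "finite ?T" "finite ?B"
    by (rule finite_subset[of _ "{1..n} \<times> {1..n}"]; use range in auto)+
  have "{(i, j). a i j \<noteq> 0} = ?T \<union> ?B" by auto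
  then have "card {(i, j). a i j \<noteq> 0} = card ?T + card ?B"
    using fin by (simp add: card_Un_disjoint disjoint_iff)
  moreover have "bij_betw (\<lambda>(i, j). (n + 1 - i, n + 1 - j)) ?R ?B"
  proof (rule bij_betw_byWitness[where f' = "\<lambda>(i, j). (n + 1 - i, n + 1 - j)"])
    have R: "1 \<le> i \<and> i \<le> n \<and> 1 \<le> j \<and> j \<le> n" if "rotate_180 n a i j \<noteq> 0" for i j
      using that range[of "n + 1 - i" "n + 1 - j"] by (auto simp: rotate_180_def)
    show "\<forall>x\<in>?R. (case case x of (i, j) \<Rightarrow> (n + 1 - i, n + 1 - j)
        of (i, j) \<Rightarrow> (n + 1 - i, n + 1 - j)) = x"
      using R by fastforce
    show "\<forall>x\<in>?B. (case case x of (i, j) \<Rightarrow> (n + 1 - i, n + 1 - j)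
        of (i, j) \<Rightarrow> (n + 1 - i, n + 1 - j)) = x"
      using range by fastforce
    show "(\<lambda>(i, j). (n + 1 - i, n + 1 - j)) ` ?R \<subseteq> ?B"
      using n_eq by (auto simp: rotate_180_def)
    show "(\<lambda>(i, j). (n + 1 - i, n + 1 - j)) ` ?B \<subseteq> ?R"
      using range n_eq by (fastforce simp: rotate_180_def)
  qed
  then have "card ?R = card ?B" by (rule bij_betw_same_card)
  ultimately show ?thesis using top_count rot.top_count by simp
qed

lemma total_count_le: "int (card {(i, j). a i j \<noteq> 0}) \<le> 2 * int m ^ 2 - 4 * int k"
  using total_count card_top_ge hollow_asm.card_top_ge[OF hollow_asm_rotate] by linarith

lemma extremal:
  assumes "int (card {(i, j). a i j \<noteq> 0}) = 2 * int m ^ 2 - 4 * int k"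
  shows "extremal_hollow_asm k m n a" "extremal_hollow_asm k m n (rotate_180 n a)"
proof -
  interpret rot: hollow_asm k m n "rotate_180 n a" by (rule hollow_asm_rotate)
  have "card top_carries = k" "card rot.top_carries = k"
    using total_count card_top_ge rot.card_top_ge assms by linarith+
  then interpret A: tight_hollow_asm k m n a + R: tight_hollow_asm k m n "rotate_180 n a"
    by unfold_locales
  \<comment> \<open>At j = n the last-column result for the rotated matrix becomes the vanishing of
    the first column sum of the original one, and vice versa.\<close>
  have "rot.col_sum m j = col_sum n (n + 1 - j) - col_sum m (n + 1 - j)" for j
    using sum_rotate[of m j] n_eq unfolding rot.col_sum_def by simp
  then have "rot.col_sum m 1 = 0" "col_sum m 1 = 0"
    using A.last_column_m R.last_column_m col_sum_n[of 1] col_sum_n[of n] n_eq m_pos by auto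
  then show "extremal_hollow_asm k m n a" "extremal_hollow_asm k m n (rotate_180 n a)"
    by unfold_locales
qed

end

lemma extremal_unique:
  assumes "hollow_asm k m n a" "hollow_asm k m n b"
    and "int (card {(i, j). a i j \<noteq> 0}) = 2 * int m ^ 2 - 4 * int k"
    and "int (card {(i, j). b i j \<noteq> 0}) = 2 * int m ^ 2 - 4 * int k"
  shows "a i j = b i j"
proof -
  interpret A: hollow_asm k m n a by fact
  interpret B: hollow_asm k m n b by fact
  note exA = A.extremal[OF assms(3)] and exB = B.extremal[OF assms(4)]
  have upper: "a i j = b i j" if "i < j" for i j
  proof -
    consider "i = 0 \<or> n < j" | "1 \<le> i" "i \<le> m" | "m < i" "j \<le> n" by linarith
    then show ?thesis
    proof cases
      case 1
      then show ?thesis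
        using A.supp[of i j] A.supp[of j i] B.supp[of i j] B.supp[of j i] A.sym[of i j]
          B.sym[of i j]
        by auto
    next
      case 2
      then show ?thesis
        using extremal_hollow_asm.entry_eq[OF exA(1)] extremal_hollow_asm.entry_eq[OF exB(1)] that
        by simp
    next
      case 3
      \<comment> \<open>The half turn combined with transposition maps the lower part of the upper
        triangle into the first m rows of the upper triangle.\<close>
      then have "1 \<le> n + 1 - j" "n + 1 - j \<le> m" "n + 1 - j < n + 1 - i"
        using A.n_eq that by auto
      then have "rotate_180 n a (n + 1 - j) (n + 1 - i) = rotate_180 n b (n + 1 - j) (n + 1 - i)"
        using extremal_hollow_asm.entry_eq[OF exA(2)] extremal_hollow_asm.entry_eq[OF exB(2)]
        by simp
      then show ?thesis using 3 that A.sym[of j i] B.sym[of j i] by (simp add: rotate_180_def)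
    qed
  qed
  then show ?thesis
    using upper[of i j] upper[of j i] A.sym[of j i] B.sym[of j i] A.diag[of i] B.diag[of i]
    by (metis linorder_neqE_nat)
qed

subsection \<open>The hollowed diamond\<close>

definition diamond_entry :: "nat \<Rightarrow> nat \<Rightarrow> nat \<Rightarrow> int" where
  "diamond_entry k i j =
     (if 2 * k + 3 \<le> i + j \<and> i + j \<le> 6 * k + 3 \<and> i \<le> j + 2 * k + 1 \<and> j \<le> i + 2 * k + 1
      then (if odd (i + j) then 1 else -1) else 0)"

text \<open>Partial column sums of the diamond: the first line says that the column has started, the
  second that the latest entry is 1 (odd i + j) or that its last nonzero entry has been
  reached.\<close>

definition diamond_prefix :: "nat \<Rightarrow> nat \<Rightarrow> nat \<Rightarrow> bool" where
  "diamond_prefix k i j \<longleftrightarrow>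
     2 * k + 3 \<le> i + j \<and> j \<le> i + 2 * k + 1 \<and>
     (odd (i + j) \<or> 6 * k + 3 \<le> i + j \<or> j + 2 * k + 1 \<le> i)"

lemma diamond_entry_step:
  assumes "1 \<le> j" "j \<le> 4 * k + 2" "p < 4 * k + 2"
  shows "diamond_entry k (Suc p) j
    = of_bool (diamond_prefix k (Suc p) j) - of_bool (diamond_prefix k p j)"
proof (cases "even (p + j)")
  case True
  \<comment> \<open>Writing the index sum through x makes every bound on i + j, and every bound on
    the difference, a linear condition without parity.\<close>
  then obtain x where x: "p + j = 2 * x" by blast
  have "2 * k + 3 \<le> Suc p + j \<longleftrightarrow> k + 1 \<le> x" "2 * k + 3 \<le> p + j \<longleftrightarrow> k + 2 \<le> x"
    "Suc p + j \<le> 6 * k + 3 \<longleftrightarrow> x \<le> 3 * k + 1" "6 * k + 3 \<le> p + j \<longleftrightarrow> 3 * k + 2 \<le> x"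
    "Suc p \<le> j + 2 * k + 1 \<longleftrightarrow> p \<le> x + k" "j + 2 * k + 1 \<le> p \<longleftrightarrow> x + k + 1 \<le> p"
    "j \<le> Suc p + 2 * k + 1 \<longleftrightarrow> x \<le> p + k + 1" "j \<le> p + 2 * k + 1 \<longleftrightarrow> x \<le> p + k"
    using x by linarith+
  moreover have "odd (Suc p + j)" "even (p + j)" using True by simp_all
  moreover have "k + 2 \<le> x \<and> x \<le> p + k" if "3 * k + 2 \<le> x \<or> x + k + 1 \<le> p"
    using that assms x by linarith
  ultimately show ?thesis unfolding diamond_entry_def diamond_prefix_def of_bool_def by auto
next
  case False
  then obtain x where x: "p + j = 2 * x + 1" by (elim oddE)
  have "2 * k + 3 \<le> Suc p + j \<longleftrightarrow> k + 1 \<le> x" "2 * k + 3 \<le> p + j \<longleftrightarrow> k + 1 \<le> x"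
    "Suc p + j \<le> 6 * k + 3 \<longleftrightarrow> x \<le> 3 * k" "6 * k + 3 \<le> Suc p + j \<longleftrightarrow> 3 * k + 1 \<le> x"
    "Suc p \<le> j + 2 * k + 1 \<longleftrightarrow> p \<le> x + k" "j + 2 * k + 1 \<le> Suc p \<longleftrightarrow> x + k + 1 \<le> p"
    "j \<le> Suc p + 2 * k + 1 \<longleftrightarrow> x \<le> p + k" "j \<le> p + 2 * k + 1 \<longleftrightarrow> x \<le> p + k"
    using x by linarith+
  moreover have "even (Suc p + j)" "odd (p + j)" using False by simp_all
  ultimately show ?thesis unfolding diamond_entry_def diamond_prefix_def of_bool_def by auto
qed

text \<open>The parity of i + k tells whether i is the smaller or the larger index of its
  block.\<close>

definition hollow_pair :: "nat \<Rightarrow> nat \<Rightarrow> nat \<Rightarrow> bool" where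
  "hollow_pair k i j \<longleftrightarrow>
     even (i + k) \<and> k + 2 \<le> i \<and> i \<le> 3 * k \<and> (j = i \<or> j = i + 1) \<or>
     odd (i + k) \<and> k + 3 \<le> i \<and> i \<le> 3 * k + 1 \<and> (j = i \<or> j + 1 = i)"

definition hollowed_entry :: "nat \<Rightarrow> nat \<Rightarrow> nat \<Rightarrow> int" where
  "hollowed_entry k i j =
     (if i = 0 \<or> j = 0 \<or> 4 * k + 2 < i \<or> 4 * k + 2 < j \<or> hollow_pair k i j then 0
      else diamond_entry k i j)"

text \<open>
  The change of the column sums caused by the removed blocks: in each of them it occurs only after
  the upper of the two rows.
\<close>

definition hollowing :: "nat \<Rightarrow> nat \<Rightarrow> nat \<Rightarrow> int" where
  "hollowing k i j =
     (if k + 2 \<le> i \<and> i \<le> 3 * k \<and> even (i + k)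
      then (if j = i then 1 else if j = i + 1 then -1 else 0) else 0)"

lemma hollow_pair_sym: "hollow_pair k i j = hollow_pair k j i"
  unfolding hollow_pair_def by auto

lemma hollow_pair_iff:
  "(\<exists>t\<in>{1..k}. {i, j} \<subseteq> {k + 2 * t, k + 2 * t + 1}) \<longleftrightarrow> hollow_pair k i j"
proof
  assume "\<exists>t\<in>{1..k}. {i, j} \<subseteq> {k + 2 * t, k + 2 * t + 1}"
  then show "hollow_pair k i j" by (auto simp: hollow_pair_def)
next
  assume *: "hollow_pair k i j"
  define t where "t = (i - k) div 2"
  have t: "i = k + 2 * t \<or> i = k + 2 * t + 1" using * unfolding t_def hollow_pair_def by presburger
  then have "t \<in> {1..k}" "{i, j} \<subseteq> {k + 2 * t, k + 2 * t + 1}"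
    using * by (auto simp: hollow_pair_def)
  then show "\<exists>t\<in>{1..k}. {i, j} \<subseteq> {k + 2 * t, k + 2 * t + 1}" by blast
qed

lemma hollowed_entry_sym: "hollowed_entry k i j = hollowed_entry k j i"
  unfolding hollowed_entry_def diamond_entry_def using hollow_pair_sym[of k i j]
  by (auto simp: add.commute)

text \<open>A block has rows (-1, 1) and (1, -1). Removing its upper row changes the column sums by
  1 and -1, and removing its lower row undoes this.\<close>

lemma hollowed_entry_step:
  assumes "1 \<le> j" "j \<le> 4 * k + 2" "p < 4 * k + 2"
  shows "hollowed_entry k (Suc p) j
    = diamond_entry k (Suc p) j + hollowing k (Suc p) j - hollowing k p j"
proof -
  consider (first) "even (Suc p + k)" "k + 2 \<le> Suc p" "Suc p \<le> 3 * k"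
    | (second) "even (p + k)" "k + 2 \<le> p" "p \<le> 3 * k"
    | (none) "\<not> (even (Suc p + k) \<and> k + 2 \<le> Suc p \<and> Suc p \<le> 3 * k)"
        "\<not> (even (p + k) \<and> k + 2 \<le> p \<and> p \<le> 3 * k)"
    by blast
  then show ?thesis
  proof cases
    case first
    then have "odd (p + k)" by simp
    then have T: "hollowing k p j = 0" "hollow_pair k (Suc p) j \<longleftrightarrow> j = Suc p \<or> j = Suc p + 1"
      "hollowing k (Suc p) j = (if j = Suc p then 1 else if j = Suc p + 1 then -1 else 0)"
      using first by (simp_all only: hollowing_def hollow_pair_def if_False simp_thms) simp_all
    have "diamond_entry k (Suc p) (Suc p) = -1" "diamond_entry k (Suc p) (Suc p + 1) = 1"
      using first by (simp_all add: diamond_entry_def)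
    then show ?thesis using T assms by (auto simp: hollowed_entry_def)
  next
    case second
    then have "odd (Suc p + k)" by simp
    then have T: "hollowing k (Suc p) j = 0" "hollow_pair k (Suc p) j \<longleftrightarrow> j = Suc p \<or> j = p"
      "hollowing k p j = (if j = p then 1 else if j = Suc p then -1 else 0)"
      using second by (simp_all only: hollowing_def hollow_pair_def if_False simp_thms) simp_all
    have "diamond_entry k (Suc p) (Suc p) = -1" "diamond_entry k (Suc p) p = 1"
      using second by (simp_all add: diamond_entry_def)
    then show ?thesis using T assms by (auto simp: hollowed_entry_def)
  next
    case none
    then have "hollowing k (Suc p) j = 0" "hollowing k p j = 0"
      by (simp_all only: hollowing_def if_False simp_thms) auto
    moreover have "\<not> hollow_pair k (Suc p) j"
      using none unfolding hollow_pair_def by auto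
    ultimately show ?thesis using assms by (simp add: hollowed_entry_def)
  qed
qed

lemma hollowed_entry_sum:
  assumes "1 \<le> j" "j \<le> 4 * k + 2" "i \<le> 4 * k + 2"
  shows "(\<Sum>r=1..i. hollowed_entry k r j) = of_bool (diamond_prefix k i j) + hollowing k i j"
  using assms
proof (induction i)
  case 0
  then show ?case by (simp add: diamond_prefix_def hollowing_def)
next
  case (Suc i)
  then show ?case using hollowed_entry_step[of j k i] diamond_entry_step[of j k i] by simp
qed

text \<open>In the upper row of a block the diamond has column sums 0 and 1, which the removal
  exchanges.\<close>

lemma hollowed_prefix_range:
  "of_bool (diamond_prefix k i j) + hollowing k i j \<in> {0, 1}"
proof -
  have "\<not> diamond_prefix k i i" if "i \<le> 3 * k" using that by (simp add: diamond_prefix_def)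
  moreover have "diamond_prefix k i (i + 1)" if "k + 2 \<le> i" using that
    by (simp add: diamond_prefix_def)
  ultimately show ?thesis by (auto simp: hollowing_def)
qed

text \<open>The diamond is nonzero on the diagonal exactly for i from k + 2 to 3 k + 1, and these
  indices are covered by the k blocks.\<close>

lemma hollowed_entry_diag: "hollowed_entry k i i = 0"
proof -
  have "hollow_pair k i i" if "2 * k + 3 \<le> i + i" "i + i \<le> 6 * k + 3"
  proof -
    have i: "k + 2 \<le> i" "i \<le> 3 * k + 1" using that by linarith+
    show ?thesis
    proof (cases "even (i + k)")
      case True
      then have "i \<noteq> 3 * k + 1" by auto
      then show ?thesis using True i by (simp add: hollow_pair_def)
    next
      case False
      then have "i \<noteq> k + 2" by auto
      then show ?thesis using False i by (simp add: hollow_pair_def)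
    qed
  qed
  then show ?thesis by (auto simp: hollowed_entry_def diamond_entry_def)
qed

text \<open>Since i and its image add up to the odd number 4 k + 3, the half turn exchanges the
  smaller and larger indices of the blocks and keeps the parity of i + j.\<close>

lemma hollowed_entry_rotate:
  assumes "1 \<le> i" "i \<le> 4 * k + 2" "1 \<le> j" "j \<le> 4 * k + 2"
  shows "hollowed_entry k (4 * k + 3 - i) (4 * k + 3 - j) = hollowed_entry k i j"
proof -
  define i' j' where "i' = 4 * k + 3 - i" and "j' = 4 * k + 3 - j"
  then have ij: "i' + i = 4 * k + 3" "j' + j = 4 * k + 3" using assms by auto
  have parity: "even (i' + k) \<longleftrightarrow> odd (i + k)" "even (i' + j') \<longleftrightarrow> even (i + j)"
    using ij by presburger+
  have bounds: "2 * k + 3 \<le> i' + j' \<longleftrightarrow> i + j \<le> 6 * k + 3" "i' + j' \<le> 6 * k + 3 \<longleftrightarrow> 2 * k + 3 \<le> i + j"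
    "i' \<le> j' + 2 * k + 1 \<longleftrightarrow> j \<le> i + 2 * k + 1" "j' \<le> i' + 2 * k + 1 \<longleftrightarrow> i \<le> j + 2 * k + 1"
    "k + 2 \<le> i' \<longleftrightarrow> i \<le> 3 * k + 1" "i' \<le> 3 * k \<longleftrightarrow> k + 3 \<le> i"
    "k + 3 \<le> i' \<longleftrightarrow> i \<le> 3 * k" "i' \<le> 3 * k + 1 \<longleftrightarrow> k + 2 \<le> i"
    "j' = i' \<longleftrightarrow> j = i" "j' = i' + 1 \<longleftrightarrow> j + 1 = i" "j' + 1 = i' \<longleftrightarrow> j = i + 1"
    using ij by linarith+
  have "\<not> (i' = 0 \<or> j' = 0 \<or> 4 * k + 2 < i' \<or> 4 * k + 2 < j')"
    "\<not> (i = 0 \<or> j = 0 \<or> 4 * k + 2 < i \<or> 4 * k + 2 < j)"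
    using ij assms by auto
  moreover have "hollow_pair k i' j' = hollow_pair k i j"
    unfolding hollow_pair_def parity bounds by blast
  moreover have "diamond_entry k i' j' = diamond_entry k i j"
    unfolding diamond_entry_def parity bounds by (intro if_cong) blast+
  ultimately have "hollowed_entry k i' j' = hollowed_entry k i j"
    unfolding hollowed_entry_def by simp
  then show ?thesis by (simp add: i'_def j'_def)
qed

lemma hollow_asm_hollowed_entry:
  assumes "m = 2 * k + 1" "n = 2 * m"
  shows "hollow_asm k m n (hollowed_entry k)"
proof
  show "m = 2 * k + 1" "n = 2 * m" by (fact assms)+
  show "hollowed_entry k i j = hollowed_entry k j i" for i j by (rule hollowed_entry_sym)
  show "hollowed_entry k i i = 0" for i
    by (rule hollowed_entry_diag)
  show out: "hollowed_entry k i j = 0" if "i = 0 \<or> n < i" for i j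
    using that assms by (auto simp: hollowed_entry_def)
  have small: "(\<Sum>r=1..i. hollowed_entry k r j) \<in> {0, 1}" if "i \<le> n" for i j
  proof (cases "1 \<le> j \<and> j \<le> n")
    case True
    then show ?thesis
      using hollowed_entry_sum[of j k i] hollowed_prefix_range[of k i j] that assms by simp
  next
    case False
    then have "hollowed_entry k r j = 0" for r using assms by (auto simp: hollowed_entry_def)
    then show ?thesis by simp
  qed
  show "(\<Sum>r=1..i. hollowed_entry k r j) \<in> {0, 1}" for i j
  proof (cases "i \<le> n")
    case False
    then have "(\<Sum>r=1..i. hollowed_entry k r j) = (\<Sum>r=1..n. hollowed_entry k r j)"
      by (intro sum.mono_neutral_right) (auto simp: out)
    then show ?thesis using small[of n j] by simp
  qed (rule small)
  show "(\<Sum>r=1..n. hollowed_entry k r j) = 1" if "1 \<le> j" "j \<le> n" for j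
    using hollowed_entry_sum[of j k n] that assms by (auto simp: diamond_prefix_def hollowing_def)
qed

text \<open>In the upper half the diamond has no carries, since consecutive rows have opposite
  parity of i + j and no column ends before row m. So a carry needs a column sum raised to 1 in the
  upper row of a block, at row i or i - 1.\<close>

lemma hollowed_carry:
  assumes "of_bool (diamond_prefix k i j) + hollowing k i j = 1"
    "of_bool (diamond_prefix k (i - 1) j) + hollowing k (i - 1) j = 1"
    "2 \<le> i" "i \<le> 2 * k + 1" "1 \<le> j" "j \<le> 4 * k + 2"
  shows "k + 2 \<le> i \<and> (if even (i + k) then j = i else j = i - 1)"
proof -
  obtain p where p: "i = Suc p" using assms by (cases i) auto
  show ?thesis
  proof (cases "hollowing k i j = 0 \<and> hollowing k p j = 0")
    case True
    then have *: "diamond_prefix k (Suc p) j" "diamond_prefix k p j" using assms p by simp_all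
    have "\<not> (j + 2 * k + 1 \<le> Suc p)" "\<not> (6 * k + 3 \<le> p + j)"
      "6 * k + 3 \<le> Suc p + j \<Longrightarrow> p + j = 6 * k + 2"
      using assms p by linarith+
    moreover from this * have "odd (p + j)" unfolding diamond_prefix_def by linarith
    ultimately show ?thesis using *(1) unfolding diamond_prefix_def
      by (metis even_add even_mult_iff even_numeral even_Suc add_Suc)
  next
    case False
    then have "hollowing k i j = 1 \<or> hollowing k p j = 1"
      using assms p by (auto simp: hollowing_def of_bool_def split: if_splits)
    then show ?thesis using p by (auto simp: hollowing_def split: if_splits)
  qed
qed

lemma hollowed_count:
  assumes "m = 2 * k + 1" "n = 2 * m"
  shows "int (card {(i, j). hollowed_entry k i j \<noteq> 0}) = 2 * int m ^ 2 - 4 * int k"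
proof -
  interpret hollow_asm k m n "hollowed_entry k" using assms by (rule hollow_asm_hollowed_entry)
  have rot: "rotate_180 n (hollowed_entry k) = hollowed_entry k"
  proof (intro ext)
    fix i j
    show "rotate_180 n (hollowed_entry k) i j = hollowed_entry k i j"
    proof (cases "1 \<le> i \<and> i \<le> n \<and> 1 \<le> j \<and> j \<le> n")
      case True
      have n: "n = 4 * k + 2" "n + 1 = 4 * k + 3" using assms by simp_all
      show ?thesis unfolding rotate_180_def n(2) using hollowed_entry_rotate[of i k j] True n(1)
        by blast
    next
      case False
      then show ?thesis using assms by (auto simp: rotate_180_def hollowed_entry_def)
    qed
  qed
  \<comment> \<open>One candidate position for each of the k rows from k + 2 to m; together with
    \<open>card_top_ge\<close> the count is exactly k.\<close>
  have "top_carries \<subseteq> (\<lambda>i. (i, if even (i + k) then i else i - 1)) ` {k+2..m}"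
  proof
    fix x assume "x \<in> top_carries"
    then obtain i j where x: "x = (i, j)" and i: "i \<le> m" and ij: "carry i j"
      by (auto simp: top_carries_def)
    have rng: "1 \<le> j" "j \<le> 4 * k + 2" "2 \<le> i" using carry_range[OF ij] assms by auto
    then have "of_bool (diamond_prefix k i j) + hollowing k i j = 1"
      "of_bool (diamond_prefix k (i - 1) j) + hollowing k (i - 1) j = 1"
      using ij i assms hollowed_entry_sum[of j k i] hollowed_entry_sum[of j k "i - 1"]
      by (auto simp: carry_def col_sum_def)
    then have "k + 2 \<le> i \<and> (if even (i + k) then j = i else j = i - 1)"
      using i rng assms by (intro hollowed_carry) auto
    then show "x \<in> (\<lambda>i. (i, if even (i + k) then i else i - 1)) ` {k+2..m}"
      using x i by (intro image_eqI[of _ _ i]) auto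
  qed
  then have "card top_carries \<le> card {k+2..m}"
    by (meson card_image_le card_mono finite_atLeastAtMost finite_imageI order_trans)
  then have "card top_carries \<le> k" using assms by simp
  then show ?thesis using total_count card_top_ge rot by simp
qed

subsection \<open>Matrices and signed graphs\<close>

text \<open>The parameter s is the running sum so far, which has to stay in {0, 1} and end at
  1.\<close>

fun balanced_from :: "int \<Rightarrow> int list \<Rightarrow> bool" where
  "balanced_from s [] \<longleftrightarrow> s = 1"
| "balanced_from s (x # xs) \<longleftrightarrow> s + x \<in> {0, 1} \<and> balanced_from (s + x) xs"

lemma balanced_from_filter:
  "s \<in> {0, 1} \<Longrightarrow> balanced_from s (filter (\<lambda>x. x \<noteq> 0) xs) = balanced_from s xs"
  by (induction xs arbitrary: s) auto

lemma balanced_from_iff_prefix_sums: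
  "s \<in> {0, 1} \<Longrightarrow> balanced_from s xs \<longleftrightarrow>
     (\<forall>i\<le>length xs. s + sum_list (take i xs) \<in> {0, 1}) \<and> s + sum_list xs = 1"
proof (induction xs arbitrary: s)
  case (Cons x xs)
  have split: "(\<forall>i\<le>length (x # xs). P i) \<longleftrightarrow> P 0 \<and> (\<forall>i\<le>length xs. P (Suc i))" for P
    by (auto simp: less_Suc_eq_le) (metis Suc_le_mono not0_implies_Suc)
  show ?case
  proof (cases "s + x \<in> {0, 1}")
    case True
    then show ?thesis using Cons.IH[OF True] Cons.prems unfolding split by (simp add: add.assoc)
  next
    case False
    then show ?thesis by (auto intro!: exI[of _ "Suc 0"])
  qed
qed auto

text \<open>Both starting values are treated together because each entry switches the running sum
  between 0 and 1.\<close>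

lemma balanced_from_iff_alternating:
  assumes "set xs \<subseteq> {1, -1}"
  shows "balanced_from 0 xs \<longleftrightarrow>
      xs \<noteq> [] \<and> hd xs = 1 \<and> last xs = 1 \<and> successively (\<lambda>x y. sgn y = - sgn x) xs"
    and "balanced_from 1 xs \<longleftrightarrow>
      xs = [] \<or> hd xs = -1 \<and> last xs = 1 \<and> successively (\<lambda>x y. sgn y = - sgn x) xs"
  using assms
proof (induction xs)
  case Nil
  { case 1 show ?case by simp }
  { case 2 show ?case by simp }
next
  case (Cons x xs)
  have IH: "set xs \<subseteq> {1, -1} \<Longrightarrow> balanced_from 0 xs \<longleftrightarrow>
      xs \<noteq> [] \<and> hd xs = 1 \<and> last xs = 1 \<and> successively (\<lambda>x y. sgn y = - sgn x) xs"
    "set xs \<subseteq> {1, -1} \<Longrightarrow> balanced_from 1 xs \<longleftrightarrow>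
      xs = [] \<or> hd xs = -1 \<and> last xs = 1 \<and> successively (\<lambda>x y. sgn y = - sgn x) xs"
    using Cons.IH by blast+
  have hd: "xs = [] \<or> hd xs = 1 \<or> hd xs = -1" if "set xs \<subseteq> {1, -1}"
    using that by (cases xs) auto
  { case 1
    then consider "x = 1" "set xs \<subseteq> {1, -1}" | "x = -1" by auto
    then show ?case
    proof cases
      case 1
      then show ?thesis using IH(2) hd by (auto simp: successively_Cons)
    qed simp }
  { case 2
    then consider "x = -1" "set xs \<subseteq> {1, -1}" | "x = 1" by auto
    then show ?case
    proof cases
      case 1
      then show ?thesis using IH(1) hd by (auto simp: successively_Cons)
    qed simp }
qed

lemma alternating_line_iff:
  assumes "\<forall>i<dim_vec v. v $ i \<in> {0, 1, -1}"
  shows "alternating_line v \<longleftrightarrow>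
    (\<forall>i\<le>dim_vec v. (\<Sum>r<i. v $ r) \<in> {0, 1}) \<and> (\<Sum>r<dim_vec v. v $ r) = 1"
proof -
  have "set (list_of_vec v) \<subseteq> {0, 1, -1}"
  proof
    fix x assume "x \<in> set (list_of_vec v)"
    then obtain i where "i < dim_vec v" "x = v $ i"
      by (auto simp: in_set_conv_nth list_of_vec_index)
    then show "x \<in> {0, 1, -1}" using assms by blast
  qed
  then have "set (nonzero_entries v) \<subseteq> {1, -1}" by (auto simp: nonzero_entries_def)
  then have "alternating_line v \<longleftrightarrow> balanced_from 0 (nonzero_entries v)"
    by (simp add: balanced_from_iff_alternating(1) alternating_line_def Let_def
        successively_conv_nth)
  also have "\<dots> \<longleftrightarrow> balanced_from 0 (list_of_vec v)"
    by (simp add: nonzero_entries_def balanced_from_filter)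
  also have "sum_list (take i (list_of_vec v)) = (\<Sum>r<i. v $ r)" if "i \<le> dim_vec v" for i
    using that by (simp add: sum_list_sum_nth lessThan_atLeast0 list_of_vec_index)
  then have "balanced_from 0 (list_of_vec v) \<longleftrightarrow>
      (\<forall>i\<le>dim_vec v. (\<Sum>r<i. v $ r) \<in> {0, 1}) \<and> (\<Sum>r<dim_vec v. v $ r) = 1"
    using balanced_from_iff_prefix_sums[of 0 "list_of_vec v"]
    by (metis (no_types, lifting) add_0 insertI1 le_refl length_list_of_vec take_all)
  finally show ?thesis .
qed

definition padded :: "int mat \<Rightarrow> nat \<Rightarrow> nat \<Rightarrow> int" where
  "padded A i j =
     (if 1 \<le> i \<and> i \<le> dim_row A \<and> 1 \<le> j \<and> j \<le> dim_col A then A $$ (i - 1, j - 1) else 0)"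

lemma sum_padded:
  assumes "A \<in> carrier_mat n n" "i \<le> n" "1 \<le> j" "j \<le> n"
  shows "(\<Sum>r=1..i. padded A r j) = (\<Sum>r<i. col A (j - 1) $ r)"
proof -
  have "(\<Sum>r=1..i. padded A r j) = (\<Sum>r<i. padded A (Suc r) j)"
    by (simp add: sum.atLeast1_atMost_eq)
  also have "\<dots> = (\<Sum>r<i. col A (j - 1) $ r)"
    using assms by (intro sum.cong) (auto simp: padded_def)
  finally show ?thesis .
qed

text \<open>Alternation of a column is the condition on its partial sums by
  \<open>alternating_line_iff\<close>. In the converse direction entries are differences of partial
  sums, and rows alternate because they are columns of the transpose.\<close>

lemma symmetric_hollow_asm_iff:
  assumes "n = 4 * k + 2" "A \<in> carrier_mat n n"
  shows "symmetric_hollow_asm n A \<longleftrightarrow> hollow_asm k (2 * k + 1) n (padded A)"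
proof
  assume A: "symmetric_hollow_asm n A"
  then have entries: "\<And>i j. i < n \<Longrightarrow> j < n \<Longrightarrow> A $$ (i, j) \<in> {0, 1, -1}"
    and cols: "\<And>j. j < n \<Longrightarrow> alternating_line (col A j)"
    and trans: "transpose_mat A = A" and diag: "\<And>i. i < n \<Longrightarrow> A $$ (i, i) = 0"
    by (auto simp: symmetric_hollow_asm_def alternating_sign_matrix_def)
  have col_sums: "(\<forall>i\<le>n. (\<Sum>r<i. col A j $ r) \<in> {0, 1}) \<and> (\<Sum>r<n. col A j $ r) = 1" if "j < n" for j
    using cols[OF that] alternating_line_iff[of "col A j"] entries that assms(2) by auto
  have small: "(\<Sum>r=1..i. padded A r j) \<in> {0, 1}" if "i \<le> n" for i j
  proof (cases "1 \<le> j \<and> j \<le> n")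
    case True
    then have "j - 1 < n" by linarith
    then show ?thesis using True sum_padded[OF assms(2) that] col_sums that by metis
  next
    case False
    then have "padded A r j = 0" for r using assms by (auto simp: padded_def)
    then show ?thesis by simp
  qed
  show "hollow_asm k (2 * k + 1) n (padded A)"
  proof
    show "2 * k + 1 = 2 * k + 1" "n = 2 * (2 * k + 1)" using assms by simp_all
    show "padded A i j = padded A j i" for i j
    proof -
      have "A $$ (p, q) = A $$ (q, p)" if "p < n" "q < n" for p q
        using that trans assms(2) by (metis carrier_matD index_transpose_mat(1))
      then show ?thesis using assms(2) by (auto simp: padded_def)
    qed
    show "padded A i i = 0" for i using diag assms(2) by (auto simp: padded_def)
    show out: "padded A i j = 0" if "i = 0 \<or> n < i" for i j
      using that assms(2) by (auto simp: padded_def)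
    show "(\<Sum>r=1..i. padded A r j) \<in> {0, 1}" for i j
    proof (cases "i \<le> n")
      case False
      then have "(\<Sum>r=1..i. padded A r j) = (\<Sum>r=1..n. padded A r j)"
        by (intro sum.mono_neutral_right) (auto simp: out)
      then show ?thesis using small[of n j] by simp
    qed (rule small)
    show "(\<Sum>r=1..n. padded A r j) = 1" if "1 \<le> j" "j \<le> n" for j
    proof -
      have "j - 1 < n" using that by linarith
      then show ?thesis using sum_padded[OF assms(2), of n j] col_sums that by simp
    qed
  qed
next
  assume "hollow_asm k (2 * k + 1) n (padded A)"
  then interpret hollow_asm k "2 * k + 1" n "padded A" .
  have A: "A $$ (p, q) = padded A (Suc p) (Suc q)" if "p < n" "q < n" for p q
    using that assms(2) by (simp add: padded_def)
  have entries: "A $$ (p, q) \<in> {0, 1, -1}" if "p < n" "q < n" for p q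
    using col_sum_step[of "Suc p" "Suc q"] col_sum_cases[of "Suc p" "Suc q"]
      col_sum_cases[of p "Suc q"] A[OF that] by auto
  have trans: "transpose_mat A = A"
    by (rule eq_matI) (use assms(2) A sym in auto)
  have cols: "alternating_line (col A j)" if "j < n" for j
  proof -
    have "(\<Sum>r<i. col A j $ r) = col_sum i (Suc j)" if "i \<le> n" for i
      using sum_padded[OF assms(2) that, of "Suc j"] \<open>j < n\<close> by (simp add: col_sum_def)
    then show ?thesis
      using alternating_line_iff[of "col A j"] entries that assms(2) col_sum_cases[of _ "Suc j"]
        col_sum_n[of "Suc j"]
      by auto
  qed
  moreover have "alternating_line (row A i)" if "i < n" for i
    using cols[OF that] trans that assms(2) by (metis carrier_matD(2) row_transpose)
  ultimately show "symmetric_hollow_asm n A"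
    unfolding symmetric_hollow_asm_def alternating_sign_matrix_def
    using assms(2) entries trans A diag by auto
qed

lemma card_padded: "num_nonzero A = card {(i, j). padded A i j \<noteq> 0}"
proof -
  have "bij_betw (\<lambda>(i, j). (Suc i, Suc j)) {(i, j). i < dim_row A \<and> j < dim_col A \<and> A $$ (i, j) \<noteq> 0}
     {(i, j). padded A i j \<noteq> 0}"
    by (rule bij_betw_byWitness[where f' = "\<lambda>(i, j). (i - 1, j - 1)"])
       (auto simp: padded_def split: if_splits)
  then show ?thesis unfolding num_nonzero_def by (rule bij_betw_same_card)
qed

lemma padded_hollowed_diamond: "padded (hollowed_diamond k) = hollowed_entry k"
proof (intro ext)
  fix i j
  show "padded (hollowed_diamond k) i j = hollowed_entry k i j"
  proof (cases "1 \<le> i \<and> i \<le> 4 * k + 2 \<and> 1 \<le> j \<and> j \<le> 4 * k + 2")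
    case True
    then have ij: "i - 1 < 4 * k + 2" "j - 1 < 4 * k + 2" "Suc (i - 1) = i" "Suc (j - 1) = j"
      by auto
    have "diamond k $$ (i - 1, j - 1) = diamond_entry k i j"
    proof -
      have "\<bar>int i - int j\<bar> \<le> int (2 * k + 1) \<longleftrightarrow> i \<le> j + 2 * k + 1 \<and> j \<le> i + 2 * k + 1"
        by linarith
      moreover have "(-1 :: int) ^ (i + j - (2 * k + 1) - 2) = (if odd (i + j) then 1 else -1)"
        if "2 * k + 3 \<le> i + j"
      proof -
        have "i + j - (2 * k + 1) - 2 = i + j - (2 * k + 3)" by linarith
        moreover have "even (i + j - (2 * k + 3)) \<longleftrightarrow> odd (i + j)" using that by simp
        ultimately show ?thesis by (simp add: minus_one_power_iff)
      qed
      ultimately show ?thesis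
        using ij by (auto simp: diamond_def diamond_entry_def Let_def)
    qed
    then show ?thesis
      using True ij hollow_pair_iff[of k i j]
      by (auto simp: padded_def hollowed_diamond_def hollowed_entry_def Let_def)
  next
    case False
    then show ?thesis
      by (auto simp: padded_def hollowed_diamond_def hollowed_entry_def Let_def)
  qed
qed

lemma hollowed_diamond_carrier: "hollowed_diamond k \<in> carrier_mat (4 * k + 2) (4 * k + 2)"
  by (simp add: hollowed_diamond_def Let_def)

lemma symmetric_hollow_asm_hollowed_diamond:
  "symmetric_hollow_asm (4 * k + 2) (hollowed_diamond k)"
  using symmetric_hollow_asm_iff[OF refl hollowed_diamond_carrier]
    hollow_asm_hollowed_entry[of "2 * k + 1" k]
  by (simp add: padded_hollowed_diamond)

lemma num_nonzero_hollowed_diamond: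
  "int (num_nonzero (hollowed_diamond k)) = 2 * int (2 * k + 1) ^ 2 - 4 * int k"
  using hollowed_count[OF refl refl, of k] by (simp add: card_padded padded_hollowed_diamond)

lemma num_nonzero_le:
  assumes "symmetric_hollow_asm (4 * k + 2) A"
  shows "int (num_nonzero A) \<le> 2 * int (2 * k + 1) ^ 2 - 4 * int k"
proof -
  have "A \<in> carrier_mat (4 * k + 2) (4 * k + 2)"
    using assms by (simp add: symmetric_hollow_asm_def alternating_sign_matrix_def)
  then show ?thesis
    using hollow_asm.total_count_le symmetric_hollow_asm_iff[OF refl] assms card_padded by metis
qed

lemma num_nonzero_eq_iff:
  assumes "symmetric_hollow_asm (4 * k + 2) A"
  shows "int (num_nonzero A) = 2 * int (2 * k + 1) ^ 2 - 4 * int k \<longleftrightarrow> A = hollowed_diamond k"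
proof
  assume count: "int (num_nonzero A) = 2 * int (2 * k + 1) ^ 2 - 4 * int k"
  have A: "A \<in> carrier_mat (4 * k + 2) (4 * k + 2)"
    using assms by (simp add: symmetric_hollow_asm_def alternating_sign_matrix_def)
  have "padded A i j = hollowed_entry k i j" for i j
  proof (rule extremal_unique)
    show "hollow_asm k (2 * k + 1) (4 * k + 2) (padded A)"
      using symmetric_hollow_asm_iff[OF refl A] assms by simp
    show "hollow_asm k (2 * k + 1) (4 * k + 2) (hollowed_entry k)"
      by (rule hollow_asm_hollowed_entry) simp_all
    show "int (card {(i, j). padded A i j \<noteq> 0}) = 2 * int (2 * k + 1) ^ 2 - 4 * int k"
      using count card_padded by simp
    show "int (card {(i, j). hollowed_entry k i j \<noteq> 0}) = 2 * int (2 * k + 1) ^ 2 - 4 * int k"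
      by (rule hollowed_count) simp_all
  qed
  then have same: "padded A (Suc p) (Suc q) = padded (hollowed_diamond k) (Suc p) (Suc q)" for p q
    by (simp add: padded_hollowed_diamond)
  show "A = hollowed_diamond k"
  proof (rule eq_matI)
    fix p q assume "p < dim_row (hollowed_diamond k)" "q < dim_col (hollowed_diamond k)"
    then show "A $$ (p, q) = hollowed_diamond k $$ (p, q)"
      using same[of p q] A hollowed_diamond_carrier[of k] by (auto simp: padded_def)
  qed (use A hollowed_diamond_carrier[of k] in auto)
qed (simp add: num_nonzero_hollowed_diamond)

text \<open>Group the nonzero positions by their edge: having two distinct endpoints, each edge
  yields two ordered pairs.\<close>

lemma num_nonzero_signed_adjacency:
  assumes "loopless_signed_graph n E \<sigma>"
  shows "num_nonzero (signed_adjacency_mat n E \<sigma>) = 2 * card E"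
proof -
  have E: "e \<subseteq> {1..n}" "card e = 2" "\<sigma> e \<noteq> 0" if "e \<in> E" for e
    using assms that by (auto simp: loopless_signed_graph_def)
  have "E \<subseteq> Pow {1..n}" using E by blast
  then have finE: "finite E" by (rule finite_subset) simp
  have "padded (signed_adjacency_mat n E \<sigma>) i j \<noteq> 0 \<longleftrightarrow> {i, j} \<in> E" for i j
    using E[of "{i, j}"]
    by (auto simp: padded_def signed_adjacency_mat_def split: if_splits)
  then have "num_nonzero (signed_adjacency_mat n E \<sigma>) = card (\<Union>e\<in>E. {(i, j). {i, j} = e})"
    unfolding card_padded by (intro arg_cong[of _ _ card]) auto
  also have "\<dots> = (\<Sum>e\<in>E. card {(i, j). {i, j} = e})"
  proof (rule card_UN_disjoint[OF finE])
    have "{(i, j). {i, j} = e} \<subseteq> e \<times> e" for e :: "nat set" by auto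
    then show "\<forall>e\<in>E. finite {(i, j). {i, j} = e}"
      using E(2) by (metis card.infinite finite_SigmaI finite_subset zero_neq_numeral)
  qed auto
  also have "\<dots> = (\<Sum>e\<in>E. 2)"
  proof (rule sum.cong[OF refl])
    fix e assume "e \<in> E"
    then obtain x y where "e = {x, y}" "x \<noteq> y" using E(2) by (meson card_2_iff)
    then have "{(i, j). {i, j} = e} = {(x, y), (y, x)}" by (auto simp: doubleton_eq_iff)
    then show "card {(i, j). {i, j} = e} = 2" using \<open>x \<noteq> y\<close> by simp
  qed
  finally show ?thesis by simp
qed

lemma hollowed_diamond_signed_graph:
  obtains E \<sigma> where "loopless_signed_graph (4 * k + 2) E \<sigma>"
    "signed_adjacency_mat (4 * k + 2) E \<sigma> = hollowed_diamond k"
proof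
  define E where "E = {{i, j} | i j. hollowed_entry k i j \<noteq> 0}"
  \<comment> \<open>Minimum and maximum order the endpoints of an edge; symmetry makes the order
    immaterial.\<close>
  define \<sigma> where "\<sigma> e = hollowed_entry k (Min e) (Max e)" for e
  have \<sigma>: "\<sigma> {i, j} = hollowed_entry k i j" for i j
    using hollowed_entry_sym[of k i j] by (simp add: \<sigma>_def min_def max_def)
  have E: "{i, j} \<in> E \<longleftrightarrow> hollowed_entry k i j \<noteq> 0" for i j
    using hollowed_entry_sym unfolding E_def by (auto simp: doubleton_eq_iff)
  have vals: "hollowed_entry k i j \<in> {0, 1, -1}" for i j
    by (simp add: hollowed_entry_def diamond_entry_def)
  show "loopless_signed_graph (4 * k + 2) E \<sigma>"
    unfolding loopless_signed_graph_def
  proof (intro conjI ballI)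
    fix e assume "e \<in> E"
    then obtain i j where e: "e = {i, j}" "hollowed_entry k i j \<noteq> 0" by (auto simp: E_def)
    then show "e \<subseteq> {1..4 * k + 2}" by (auto simp: hollowed_entry_def split: if_splits)
    show "card e = 2" using e hollowed_entry_diag[of k i] by (cases "i = j") auto
    show "\<sigma> e \<in> {1, -1}" using e \<sigma> vals[of i j] by auto
  qed
  show "signed_adjacency_mat (4 * k + 2) E \<sigma> = hollowed_diamond k"
  proof (rule eq_matI)
    fix p q assume "p < dim_row (hollowed_diamond k)" "q < dim_col (hollowed_diamond k)"
    then show "signed_adjacency_mat (4 * k + 2) E \<sigma> $$ (p, q) = hollowed_diamond k $$ (p, q)"
      using E[of "Suc p" "Suc q"] \<sigma>[of "Suc p" "Suc q"] hollowed_diamond_carrier[of k]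
        padded_hollowed_diamond[of k, THEN fun_cong, THEN fun_cong, of "Suc p" "Suc q"]
      by (auto simp: signed_adjacency_mat_def padded_def)
  qed (use hollowed_diamond_carrier[of k] in \<open>auto simp: signed_adjacency_mat_def\<close>)
qed

theorem theorem5p2:
  fixes n k :: nat
  assumes "n = 4 * k + 2"
  shows "((\<exists>A. symmetric_hollow_asm n A \<and>
             real (num_nonzero A) = ((real n)\<^sup>2 - 2 * real n + 4) / 2) \<and>
          (\<forall>A. symmetric_hollow_asm n A \<longrightarrow>
             real (num_nonzero A) \<le> ((real n)\<^sup>2 - 2 * real n + 4) / 2)) \<and>
         ((\<exists>E \<sigma>. loopless_alternating_signed_graph n E \<sigma> \<and>
             real (card E) = ((real n)\<^sup>2 - 2 * real n + 4) / 4) \<and>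
          (\<forall>E \<sigma>. loopless_alternating_signed_graph n E \<sigma> \<longrightarrow>
             real (card E) \<le> ((real n)\<^sup>2 - 2 * real n + 4) / 4)) \<and>
         (\<forall>A. symmetric_hollow_asm n A \<longrightarrow>
             (real (num_nonzero A) = ((real n)\<^sup>2 - 2 * real n + 4) / 2 \<longleftrightarrow>
              A = hollowed_diamond k))"
proof -
  \<comment> \<open>The bound in integers, 2 m^2 - 4 k with m = 2 k + 1, on which the counting
    lemmas are stated.\<close>
  define b where "b = 2 * int (2 * k + 1) ^ 2 - 4 * int k"
  have b: "((real n)\<^sup>2 - 2 * real n + 4) / 2 = of_int b"
    unfolding b_def assms by (simp add: power2_eq_square algebra_simps)
  have b4: "((real n)\<^sup>2 - 2 * real n + 4) / 4 = of_int b / 2" using b by simp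
  have le: "real (num_nonzero A) \<le> of_int b" if "symmetric_hollow_asm n A" for A
    using num_nonzero_le[of k A] that assms unfolding b_def
      by (metis of_int_le_iff of_int_of_nat_eq)
  have eq: "real (num_nonzero A) = of_int b \<longleftrightarrow> A = hollowed_diamond k"
    if "symmetric_hollow_asm n A" for A
    using num_nonzero_eq_iff[of k A] that assms unfolding b_def
      by (metis of_int_eq_iff of_int_of_nat_eq)
  have D: "symmetric_hollow_asm n (hollowed_diamond k)"
    using symmetric_hollow_asm_hollowed_diamond assms by simp
  obtain E \<sigma> where E: "loopless_signed_graph n E \<sigma>"
    "signed_adjacency_mat n E \<sigma> = hollowed_diamond k"
    using hollowed_diamond_signed_graph assms by metis
  have card: "real (card E) = real (num_nonzero (signed_adjacency_mat n E \<sigma>)) / 2"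
    if "loopless_signed_graph n E \<sigma>" for E \<sigma>
    using num_nonzero_signed_adjacency[OF that] by simp
  show ?thesis
    unfolding b b4
  proof (intro conjI)
    show "\<exists>A. symmetric_hollow_asm n A \<and> real (num_nonzero A) = of_int b" using D eq by blast
    show "\<forall>A. symmetric_hollow_asm n A \<longrightarrow> real (num_nonzero A) \<le> of_int b" using le by blast
    show "\<exists>E \<sigma>. loopless_alternating_signed_graph n E \<sigma> \<and> real (card E) = of_int b / 2"
    proof (intro exI conjI)
      show "loopless_alternating_signed_graph n E \<sigma>"
        using E D by (simp add: loopless_alternating_signed_graph_def)
      show "real (card E) = of_int b / 2" using card[OF E(1)] E(2) eq[OF D] by simp
    qed
    show "\<forall>E \<sigma>. loopless_alternating_signed_graph n E \<sigma> \<longrightarrow> real (card E) \<le> of_int b / 2"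
      using card le by (auto simp: loopless_alternating_signed_graph_def)
    show "\<forall>A. symmetric_hollow_asm n A \<longrightarrow>
        (real (num_nonzero A) = of_int b \<longleftrightarrow> A = hollowed_diamond k)" using eq by blast
  qed
qed

end
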